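(* Let $p_1,p_2\ge2$, $p=p_1p_2$. Let $f$ be a scalar-valued smooth map on $(\mathcal{C}_{p_1,p_2}^{++},g^E)$, where $g^E$ is the Euclidean metric $g^E_C(U,V)=\mathrm{tr}(U^\top V)$. Let $C\in\mathcal{C}_{p_1,p_2}^{++}$ and $V\in T_C\mathcal{C}_{p_1,p_2}^{++}$. Define $\mathcal{G}:\mathcal{S}_p\to\mathcal{S}_p$ by $$\mathcal{G}(X)=X-\frac1{p_2}(I_{p_2}\otimes\mathrm{tr}_1(X))-\frac1{p_1}(\mathrm{tr}_2(X)\otimes I_{p_1})+\frac{\mathrm{tr}(X)}{p}I_p.$$ Then the Riemannian gradient and Riemannian Hessian operator of $f$ are $$\mathrm{grad} f(C)=\mathcal{G}(\nabla f(C)),\qquad \mathrm{Hess} f(C)[V]=\mathcal{G}(\nabla^2f(C)[V]).$$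
   Context: $\mathcal{S}_p$, $\mathcal{S}_p^{++}$: real symmetric, resp. symmetric positive definite, $p\times p$ matrices. For $M\in\mathcal{S}_p$ with $p_1\times p_1$ blocks $M_{[i,j]}$ ($1\le i,j\le p_2$), $\mathrm{tr}_1(M)=\sum_iM_{[i,i]}$ and $\mathrm{tr}_2(M)$ is the $p_2\times p_2$ matrix with entries $\mathrm{tr}(M_{[i,j]})$. $\mathcal{C}_{p_1,p_2}^{++}=\{C\in\mathcal{S}_p^{++}:k(C)=I_p\}$, where $k(\Sigma)$ is the unique minimizer of $\mathrm{tr}(\Sigma(K_2\otimes K_1)^{-1})+p_1\log|K_2|+p_2\log|K_1|$ over $K_2\otimes K_1$, $K_i$ positive definite $p_i\times p_i$; equivalently $\mathcal{C}_{p_1,p_2}^{++}=\{C\in\mathcal{S}_p^{++}:\mathrm{tr}_1(C)=p_2I_{p_1},\mathrm{tr}_2(C)=p_1I_{p_2}\}$. It is an embedded submanifold of $\mathcal{S}_p^{++}$ with $T_C\mathcal{C}_{p_1,p_2}^{++}=\{W\in\mathcal{S}_p:\mathrm{tr}_1(W)=0,\mathrm{tr}_2(W)=0\}$. $\nabla f(C)\in\mathcal{S}_p$ and $\nabla^2f(C)[V]\in\mathcal{S}_p$ denote the Euclidean gradient and the Euclidean Hessian operator applied to $V$ (of a smooth extension of $f$ to a neighbourhood of $C$ in $\mathcal{S}_p$, with respect to the trace inner product). The Riemannian Hessian operator is the Levi-Civita covariant derivative of the Riemannian gradient. *)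

theory Defs
  imports "HOL-Analysis.Analysis"
begin

section \<open>Smooth maps\<close>

text \<open>
  \<open>Ck_on k S f\<close>: all iterated directional derivatives of order at most \<open>k\<close> exist in the
  Frechet sense and are continuous. It is meant for sets \<open>S\<close> that are relatively open in a linear
  subspace \<open>E\<close>. The derivative \<open>f' x\<close> within \<open>S\<close> is then determined exactly on \<open>E\<close>, and its
  values off \<open>E\<close> are immaterial: composing \<open>f' x\<close> with the orthogonal projection onto \<open>E\<close> shows
  that the quantification over all directions \<open>v\<close> is the same as quantification over \<open>v \<in> E\<close>.
\<close>

primrec Ck_on :: "nat \<Rightarrow> 'a::euclidean_space set \<Rightarrow> ('a \<Rightarrow> 'b::euclidean_space) \<Rightarrow> bool" where
  "Ck_on 0 S f \<longleftrightarrow> continuous_on S f"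
| "Ck_on (Suc k) S f \<longleftrightarrow>
     (\<exists>f'. (\<forall>x\<in>S. (f has_derivative f' x) (at x within S)) \<and> (\<forall>v. Ck_on k S (\<lambda>x. f' x v)))"

definition smooth_on :: "'a::euclidean_space set \<Rightarrow> ('a \<Rightarrow> 'b::euclidean_space) \<Rightarrow> bool" where
  "smooth_on S f \<longleftrightarrow> (\<forall>k. Ck_on k S f)"


section \<open>Riemannian geometry of embedded submanifolds\<close>

text \<open>
  Throughout, \<open>M\<close> is an embedded submanifold of a Euclidean space. Maps on \<open>M\<close> are
  represented by functions on the ambient type, of which only the values on \<open>M\<close> matter.
\<close>

definition smooth_map_on ::
    "'a::euclidean_space set \<Rightarrow> ('a \<Rightarrow> 'b::euclidean_space) \<Rightarrow> bool" where
  "smooth_map_on M f \<longleftrightarrow>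
     (\<forall>x\<in>M. \<exists>U F. open U \<and> x \<in> U \<and> smooth_on U F \<and> (\<forall>y\<in>M \<inter> U. F y = f y))"

definition curve_through ::
    "'a::euclidean_space set \<Rightarrow> 'a \<Rightarrow> 'a \<Rightarrow> (real \<Rightarrow> 'a) \<Rightarrow> bool" where
  "curve_through M x v \<gamma> \<longleftrightarrow>
     (\<exists>e>0. smooth_on {-e<..<e} \<gamma> \<and> \<gamma> ` {-e<..<e} \<subseteq> M) \<and>
     \<gamma> 0 = x \<and> (\<gamma> has_vector_derivative v) (at 0)"

definition tangent_space :: "'a::euclidean_space set \<Rightarrow> 'a \<Rightarrow> 'a set" where
  "tangent_space M x = {v. \<exists>\<gamma>. curve_through M x v \<gamma>}"

definition mdiff :: "'a::euclidean_space set \<Rightarrow> ('a \<Rightarrow> real) \<Rightarrow> 'a \<Rightarrow> 'a \<Rightarrow> real" where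
  "mdiff M f x v =
     (THE d. \<forall>\<gamma>. curve_through M x v \<gamma> \<longrightarrow> ((f \<circ> \<gamma>) has_real_derivative d) (at 0))"

text \<open>Vector fields are set to 0 off \<open>M\<close>, so that a field is determined by its values on \<open>M\<close>.\<close>

definition vector_fields :: "'a::euclidean_space set \<Rightarrow> ('a \<Rightarrow> 'a) set" where
  "vector_fields M =
     {X. smooth_map_on M X \<and> (\<forall>x\<in>M. X x \<in> tangent_space M x) \<and> (\<forall>x. x \<notin> M \<longrightarrow> X x = 0)}"

text \<open>
  The last clause only normalises the value of a connection on arguments that are not vector
  fields, which makes the Levi-Civita connection unique as a function.
\<close>

definition affine_connection ::
    "'a::euclidean_space set \<Rightarrow> (('a \<Rightarrow> 'a) \<Rightarrow> ('a \<Rightarrow> 'a) \<Rightarrow> 'a \<Rightarrow> 'a) \<Rightarrow> bool" where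
  "affine_connection M D \<longleftrightarrow>
     (\<forall>X\<in>vector_fields M. \<forall>Y\<in>vector_fields M. D X Y \<in> vector_fields M) \<and>
     (\<forall>X\<in>vector_fields M. \<forall>X'\<in>vector_fields M. \<forall>Y\<in>vector_fields M.
        \<forall>f h. smooth_map_on M f \<and> smooth_map_on M h \<longrightarrow>
          D (\<lambda>x. f x *\<^sub>R X x + h x *\<^sub>R X' x) Y = (\<lambda>x. f x *\<^sub>R D X Y x + h x *\<^sub>R D X' Y x)) \<and>
     (\<forall>X\<in>vector_fields M. \<forall>Y\<in>vector_fields M. \<forall>Y'\<in>vector_fields M. \<forall>a b::real.
        D X (\<lambda>x. a *\<^sub>R Y x + b *\<^sub>R Y' x) = (\<lambda>x. a *\<^sub>R D X Y x + b *\<^sub>R D X Y' x)) \<and>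
     (\<forall>X\<in>vector_fields M. \<forall>Y\<in>vector_fields M. \<forall>f. smooth_map_on M f \<longrightarrow>
        D X (\<lambda>x. f x *\<^sub>R Y x) = (\<lambda>x. f x *\<^sub>R D X Y x + mdiff M f x (X x) *\<^sub>R Y x)) \<and>
     (\<forall>X Y. X \<notin> vector_fields M \<or> Y \<notin> vector_fields M \<longrightarrow> D X Y = (\<lambda>_. 0))"

text \<open>\<open>D\<^sub>X Y - D\<^sub>Y X = [X, Y]\<close>, as derivations of smooth functions.\<close>

definition torsion_free ::
    "'a::euclidean_space set \<Rightarrow> (('a \<Rightarrow> 'a) \<Rightarrow> ('a \<Rightarrow> 'a) \<Rightarrow> 'a \<Rightarrow> 'a) \<Rightarrow> bool" where
  "torsion_free M D \<longleftrightarrow>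
     (\<forall>X\<in>vector_fields M. \<forall>Y\<in>vector_fields M. \<forall>f. smooth_map_on M f \<longrightarrow>
        (\<forall>x\<in>M. mdiff M f x (D X Y x - D Y X x) =
           mdiff M (\<lambda>y. mdiff M f y (Y y)) x (X x) - mdiff M (\<lambda>y. mdiff M f y (X y)) x (Y x)))"

definition metric_compatible ::
    "'a::euclidean_space set \<Rightarrow> ('a \<Rightarrow> 'a \<Rightarrow> 'a \<Rightarrow> real) \<Rightarrow>
     (('a \<Rightarrow> 'a) \<Rightarrow> ('a \<Rightarrow> 'a) \<Rightarrow> 'a \<Rightarrow> 'a) \<Rightarrow> bool" where
  "metric_compatible M g D \<longleftrightarrow>
     (\<forall>X\<in>vector_fields M. \<forall>Y\<in>vector_fields M. \<forall>Z\<in>vector_fields M. \<forall>x\<in>M.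
        mdiff M (\<lambda>y. g y (Y y) (Z y)) x (X x) = g x (D X Y x) (Z x) + g x (Y x) (D X Z x))"

definition levi_civita ::
    "'a::euclidean_space set \<Rightarrow> ('a \<Rightarrow> 'a \<Rightarrow> 'a \<Rightarrow> real) \<Rightarrow>
     ('a \<Rightarrow> 'a) \<Rightarrow> ('a \<Rightarrow> 'a) \<Rightarrow> 'a \<Rightarrow> 'a" where
  "levi_civita M g =
     (THE D. affine_connection M D \<and> torsion_free M D \<and> metric_compatible M g D)"

definition rgrad ::
    "'a::euclidean_space set \<Rightarrow> ('a \<Rightarrow> 'a \<Rightarrow> 'a \<Rightarrow> real) \<Rightarrow> ('a \<Rightarrow> real) \<Rightarrow> 'a \<Rightarrow> 'a" where
  "rgrad M g f = (\<lambda>x. if x \<in> M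
     then (THE w. w \<in> tangent_space M x \<and> (\<forall>v\<in>tangent_space M x. g x w v = mdiff M f x v))
     else 0)"

text \<open>
  The covariant derivative of the gradient in the direction of a tangent vector \<open>v\<close> is taken
  along any vector field extending \<open>v\<close>; it does not depend on the extension.
\<close>

definition rhess ::
    "'a::euclidean_space set \<Rightarrow> ('a \<Rightarrow> 'a \<Rightarrow> 'a \<Rightarrow> real) \<Rightarrow> ('a \<Rightarrow> real) \<Rightarrow> 'a \<Rightarrow> 'a \<Rightarrow> 'a" where
  "rhess M g f x v =
     (THE w. \<exists>X\<in>vector_fields M. X x = v \<and> levi_civita M g X (rgrad M g f) x = w)"


section \<open>Symmetric matrices and Euclidean derivatives\<close>

definition sym_mats :: "(real^'k^'k) set" where
  "sym_mats = {A. transpose A = A}"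

definition spd_mats :: "(real^'k^'k) set" where
  "spd_mats = {A \<in> sym_mats. \<forall>x. x \<noteq> 0 \<longrightarrow> x \<bullet> (A *v x) > 0}"

definition trace_inner :: "real^'k^'k \<Rightarrow> real^'k^'k \<Rightarrow> real" where
  "trace_inner U V = trace (transpose U ** V)"

definition gE :: "real^'k^'k \<Rightarrow> real^'k^'k \<Rightarrow> real^'k^'k \<Rightarrow> real" where
  "gE C U V = trace_inner U V"

text \<open>
  Gradient and Hessian operator in the Euclidean space of symmetric matrices, for a function
  defined near \<open>C\<close> in that space. A derivative within \<open>sym_mats\<close> is determined on the directions
  in \<open>sym_mats\<close>, and \<open>ehess F C\<close> is applied to such directions only.
\<close>

definition egrad :: "(real^'k^'k \<Rightarrow> real) \<Rightarrow> real^'k^'k \<Rightarrow> real^'k^'k" where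
  "egrad F C =
     (THE G. G \<in> sym_mats \<and> (F has_derivative (\<lambda>V. trace_inner G V)) (at C within sym_mats))"

definition ehess :: "(real^'k^'k \<Rightarrow> real) \<Rightarrow> real^'k^'k \<Rightarrow> real^'k^'k \<Rightarrow> real^'k^'k" where
  "ehess F C V = frechet_derivative (egrad F) (at C within sym_mats) V"


section \<open>Block matrices and core covariance matrices\<close>

text \<open>
  With \<open>CARD('m) = p\<^sub>1\<close> and \<open>CARD('n) = p\<^sub>2\<close>, the rows and columns of a \<open>p\<^sub>1 p\<^sub>2 \<times> p\<^sub>1 p\<^sub>2\<close> matrix
  are indexed by pairs \<open>(i, a)\<close>, where \<open>i :: 'n\<close> is the block and \<open>a :: 'm\<close> the position in it.
\<close>

type_synonym ('n, 'm) bmat = "real^('n \<times> 'm)^('n \<times> 'm)"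

definition block :: "('n::finite, 'm::finite) bmat \<Rightarrow> 'n \<Rightarrow> 'n \<Rightarrow> real^'m^'m" where
  "block A i j = (\<chi> a b. A $ (i, a) $ (j, b))"

definition tr1 :: "('n::finite, 'm::finite) bmat \<Rightarrow> real^'m^'m" where
  "tr1 A = (\<Sum>i\<in>UNIV. block A i i)"

definition tr2 :: "('n::finite, 'm::finite) bmat \<Rightarrow> real^'n^'n" where
  "tr2 A = (\<chi> i j. trace (block A i j))"

definition kron :: "real^'n^'n \<Rightarrow> real^'m^'m \<Rightarrow> ('n::finite, 'm::finite) bmat" where
  "kron A B = (\<chi> r s. A $ fst r $ fst s * B $ snd r $ snd s)"

definition kron_objective ::
    "('n::finite, 'm::finite) bmat \<Rightarrow> (real^'n^'n) \<times> (real^'m^'m) \<Rightarrow> real" where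
  "kron_objective S = (\<lambda>(K2, K1). trace (S ** matrix_inv (kron K2 K1))
     + real CARD('m) * ln (det K2) + real CARD('n) * ln (det K1))"

text \<open>
  \<open>is_k S K\<close> says that \<open>K\<close> is the unique minimizer \<open>k(S)\<close>. Uniqueness concerns the product
  \<open>kron K2 K1\<close>; the factors are determined only up to reciprocal scalings.
\<close>

definition is_k :: "('n::finite, 'm::finite) bmat \<Rightarrow> ('n, 'm) bmat \<Rightarrow> bool" where
  "is_k S K \<longleftrightarrow>
     {kron K2 K1 | K2 K1. is_arg_min (kron_objective S) (\<lambda>z. z \<in> spd_mats \<times> spd_mats) (K2, K1)} = {K}"

definition core_covs :: "('n::finite, 'm::finite) bmat set" where
  "core_covs = {C \<in> spd_mats. is_k C (mat 1)}"

definition G_op :: "('n::finite, 'm::finite) bmat \<Rightarrow> ('n, 'm) bmat" where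
  "G_op X = X - (1 / real CARD('n)) *\<^sub>R kron (mat 1) (tr1 X)
     - (1 / real CARD('m)) *\<^sub>R kron (tr2 X) (mat 1)
     + (trace X / real (CARD('m) * CARD('n))) *\<^sub>R mat 1"

end

theory Submission
  imports Defs
begin

text \<open>
  Diagonalising \<open>K2\<close> and \<open>K1\<close> reduces the Kronecker objective to the scalar inequality
  \<open>1 / x + ln x \<ge> 1\<close>, and this identifies \<open>core_covs\<close> with the positive definite matrices whose
  partial traces are the prescribed multiples of the identity. So \<open>core_covs\<close> is relatively open in
  an affine subspace of the matrix space. On such a set every tangent space is the direction of the
  affine subspace, and the Levi-Civita connection of the Euclidean metric is the ordinary directional
  derivative. Since \<open>G_op\<close> is the orthogonal projection of the symmetric matrices onto that direction,
  the Riemannian gradient is the projected Euclidean gradient; differentiating this identity along a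
  straight line and using that \<open>G_op\<close> is linear gives the Hessian.
\<close>

section \<open>Orthogonal diagonalisation\<close>

text \<open>\<open>mdiff\<close>, \<open>levi_civita\<close>, \<open>rgrad\<close>,
  \<open>rhess\<close> and \<open>egrad\<close> are definite descriptions, so each must be shown to
  exist and to be unique before it can be computed. The obstacle throughout is that functions are
  controlled on thin sets only: \<open>f\<close> on \<open>core_covs\<close>, \<open>F\<close> on a
  relatively open set of symmetric matrices. Neither need have an ambient derivative, so derivatives
  pass through local smooth extensions, through straight lines that stay inside the set, or are
  taken within \<open>sym_mats\<close>. On a curved submanifold the Hessian would contain a second
  fundamental form term, which comes from differentiating the tangential projection. Here the
  tangent space is the same at every point and the projection is constant, so this term is absent.
  The partial trace conditions are the first-order conditions for varying a single eigenvalue of one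
  Kronecker factor.\<close>

lemma self_adjoint_eigenvector:
  fixes f :: "'a::euclidean_space \<Rightarrow> 'a"
  assumes "linear f" and sa: "\<And>x y. f x \<bullet> y = x \<bullet> f y"
    and S: "subspace S" "f ` S \<subseteq> S" "S \<noteq> {0}"
  obtains u c where "u \<in> S" "norm u = 1" "f u = c *\<^sub>R u"
proof -
  interpret linear f by fact
  let ?K = "sphere 0 1 \<inter> S"
  have "compact ?K"
    by (intro compact_Int_closed compact_sphere closed_subspace S)
  obtain s where s: "s \<in> S" "s \<noteq> 0"
    using S subspace_0 by blast
  then have "(1 / norm s) *\<^sub>R s \<in> ?K"
    using S by (auto simp: subspace_scale)
  moreover have "continuous_on ?K (\<lambda>x. x \<bullet> f x)"
    by (intro continuous_intros linear_continuous_on) (simp add: \<open>linear f\<close> linear_conv_bounded_linear[symmetric])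
  \<comment> \<open>The candidate maximizes the quadratic form of \<open>f\<close> on the unit
    sphere of \<open>S\<close>; being an eigenvector is its first-order condition.\<close>
  ultimately obtain u where u: "u \<in> ?K" and max: "\<And>x. x \<in> ?K \<Longrightarrow> x \<bullet> f x \<le> u \<bullet> f u"
    using continuous_attains_sup[OF \<open>compact ?K\<close>] by blast
  define c where "c = u \<bullet> f u"
  have u1: "u \<in> S" "norm u = 1" "u \<bullet> u = 1"
    using u by (auto simp: norm_eq_1)
  have le: "x \<bullet> f x \<le> c * (x \<bullet> x)" if "x \<in> S" for x
  proof (cases "x = 0")
    case False
    then have "(1 / norm x) *\<^sub>R x \<in> ?K"
      using S that by (auto simp: subspace_scale)
    from max[OF this] have "(x \<bullet> f x) / (norm x)\<^sup>2 \<le> c"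
      by (simp add: scale c_def power2_eq_square)
    then show ?thesis
      using False by (simp add: divide_le_eq power2_norm_eq_inner)
  qed (simp add: zero)
  have orth: "w \<bullet> f u = 0" if w: "w \<in> S" "w \<bullet> u = 0" for w
  proof -
    define b where "b = w \<bullet> f u"
    define a where "a = c * (w \<bullet> w) - w \<bullet> f w"
    \<comment> \<open>Insert \<open>u + t *\<^sub>R w\<close> into the bound \<open>le\<close>. The
      terms of order zero cancel by the choice of \<open>c\<close>, which leaves a linear term
      against a quadratic one.\<close>
    have *: "2 * t * b \<le> t\<^sup>2 * a" for t
    proof -
      have "u + t *\<^sub>R w \<in> S"
        using S u1 w by (simp add: subspace_add subspace_scale)
      from le[OF this] show ?thesis
        using w u1 sa[of u w] sa[of w u]
        by (simp add: add scale inner_add_left inner_add_right inner_commute c_def[symmetric] b_def[symmetric] a_def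
            power2_eq_square algebra_simps)
    qed
    have a: "a \<ge> 0" using le[OF w(1)] by (simp add: a_def)
    \<comment> \<open>The linear coefficient must vanish because the inequality holds for all
      \<open>t\<close>. The choice \<open>t = b / (a + 1)\<close> shows this at once; the
      \<open>+ 1\<close> avoids a division by zero when \<open>a = 0\<close>.\<close>
    have "b * b \<le> 0"
    proof -
      have "2 * (b / (a + 1)) * b \<le> (b / (a + 1))\<^sup>2 * a" by (rule *)
      then have "(2 * (b / (a + 1)) * b) * (a+1)\<^sup>2 \<le> ((b / (a + 1))\<^sup>2 * a) * (a+1)\<^sup>2"
        by (rule mult_right_mono) simp
      moreover have "(2 * (b / (a + 1)) * b) * (a+1)\<^sup>2 = 2 * b * b * (a + 1)"
        using a by (simp add: power2_eq_square)
      moreover have "((b / (a + 1))\<^sup>2 * a) * (a+1)\<^sup>2 = b * b * a"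
        using a by (simp add: power2_eq_square)
      ultimately have "2 * b * b * (a + 1) \<le> b * b * a" by (simp only:)
      then have "b * b * (a + 2) \<le> 0" by (simp add: algebra_simps)
      then show ?thesis using a by (simp add: mult_le_0_iff)
    qed
    then show ?thesis
      by (auto simp: b_def mult_le_0_iff)
  qed
  define r where "r = f u - c *\<^sub>R u"
  have rS: "r \<in> S"
    unfolding r_def using S u1 by (auto intro!: subspace_diff subspace_scale)
  have ru: "r \<bullet> u = 0"
    by (simp add: r_def inner_diff_left u1(3) c_def sa)
  have "r \<bullet> r = 0"
    using orth[OF rS ru] ru by (simp add: r_def inner_diff_right inner_diff_left)
  then have "f u = c *\<^sub>R u" by (simp add: r_def)
  with u1 that show ?thesis by blast
qed

text \<open>By self-adjointness the orthogonal complement of an eigenvector is again invariant.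
  Arbitrary invariant subspaces \<open>S\<close> are allowed so that the induction on the dimension
  can pass to this complement.\<close>

lemma self_adjoint_orthonormal_eigenbasis:
  fixes f :: "'a::euclidean_space \<Rightarrow> 'a"
  assumes lin: "linear f" and sa: "\<And>x y. f x \<bullet> y = x \<bullet> f y"
    and S: "subspace S" "f ` S \<subseteq> S"
  shows "\<exists>B. finite B \<and> B \<subseteq> S \<and> card B = dim S \<and> pairwise orthogonal B \<and>
    (\<forall>u\<in>B. norm u = 1 \<and> (\<exists>c. f u = c *\<^sub>R u))"
  using S
proof (induction "dim S" arbitrary: S)
  case 0
  then show ?case
    by (intro exI[of _ "{}"]) (auto simp: pairwise_def)
next
  case (Suc n)
  then have "S \<noteq> {0}" by auto
  from self_adjoint_eigenvector[OF lin sa Suc.prems this]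
  obtain u c where u: "u \<in> S" "norm u = 1" "f u = c *\<^sub>R u" by metis
  let ?S = "{y \<in> S. \<forall>x\<in>span {u}. orthogonal x y}"
  have S': "?S = {y \<in> S. u \<bullet> y = 0}"
    by (auto simp: orthogonal_def span_singleton)
  have "dim ?S + dim (span {u}) = dim S"
    using Suc.prems u by (intro dim_subspace_orthogonal_to_vectors) (auto dest: span_minimal[of "{u}" S, THEN subsetD, rotated 2])
  moreover have "dim (span {u}) = 1"
    using u by (auto simp: dim_singleton)
  ultimately have d: "n = dim ?S" using Suc.hyps(2) by simp
  have "subspace ?S"
    unfolding S' using Suc.prems(1)
    by (auto simp: subspace_def inner_add_right)
  moreover have "f ` ?S \<subseteq> ?S"
    unfolding S' using Suc.prems(2) u(3) by (auto simp: sa[symmetric])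
  ultimately obtain B where B: "finite B" "B \<subseteq> ?S" "card B = dim ?S" "pairwise orthogonal B"
    "\<forall>u\<in>B. norm u = 1 \<and> (\<exists>c. f u = c *\<^sub>R u)"
    using Suc.hyps(1)[OF d] by auto
  have "u \<notin> B" using B(2) u(2) by (auto simp: S' norm_eq_1)
  moreover have "pairwise orthogonal (insert u B)"
    using B(2,4) unfolding S' pairwise_insert by (auto simp: orthogonal_def inner_commute)
  ultimately show ?case
    using B u d Suc.hyps(2) by (intro exI[of _ "insert u B"]) auto
qed

definition diag_mat :: "('k \<Rightarrow> real) \<Rightarrow> real^'k^'k" where
  "diag_mat d = (\<chi> i j. if i = j then d i else 0)"

lemma matrix_diag_mult: "(A ** diag_mat d) $ i $ j = A $ i $ j * d j"
  by (simp add: matrix_matrix_mult_def diag_mat_def if_distrib cong: if_cong)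

lemma diag_matrix_mult: "(diag_mat d ** A) $ i $ j = d i * A $ i $ j"
  by (simp add: matrix_matrix_mult_def diag_mat_def if_distrib if_distribR cong: if_cong)

theorem symmetric_matrix_diagonalization:
  fixes A :: "real^'k^'k"
  assumes A: "A \<in> sym_mats"
  obtains P d where "orthogonal_matrix P" "A = P ** diag_mat d ** transpose P"
proof -
  have "(A *v x) \<bullet> y = x \<bullet> (A *v y)" for x y
    using A dot_lmul_matrix[of x A y] by (simp add: sym_mats_def flip: transpose_matrix_vector)
  from self_adjoint_orthonormal_eigenbasis[OF matrix_vector_mul_linear this subspace_UNIV]
  obtain B where B: "finite B" "card B = CARD('k)" "pairwise orthogonal B"
     "\<forall>u\<in>B. norm u = 1 \<and> (\<exists>c. A *v u = c *\<^sub>R u)"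
    by auto
  obtain b :: "'k \<Rightarrow> real^'k" where b: "bij_betw b UNIV B"
    using B finite_same_card_bij[of "UNIV::'k set" B] by auto
  then have bB: "b i \<in> B" for i by (auto simp: bij_betw_def)
  then have "\<forall>i. \<exists>c. A *v b i = c *\<^sub>R b i" using B by blast
  then obtain d where d: "\<And>i. A *v b i = d i *\<^sub>R b i" by metis
  define P :: "real^'k^'k" where "P = (\<chi> i j. b j $ i)"
  have col: "column i P = b i" for i by (simp add: column_def P_def vec_eq_iff)
  have "orthogonal_matrix P"
    unfolding orthogonal_matrix_orthonormal_columns col
    using B bB b by (auto simp: pairwise_def bij_betw_def inj_on_def) metis
  moreover have "A ** P = P ** diag_mat d"
  proof -
    have "(A ** P) $ i $ j = (P ** diag_mat d) $ i $ j" for i j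
    proof -
      have "(A ** P) $ i $ j = (A *v b j) $ i"
        by (simp add: matrix_matrix_mult_def matrix_vector_mult_def P_def)
      then show ?thesis by (simp add: d matrix_diag_mult P_def)
    qed
    then show ?thesis by (simp add: vec_eq_iff)
  qed
  then have "A ** (P ** transpose P) = P ** diag_mat d ** transpose P"
    by (simp add: matrix_mul_assoc)
  ultimately show ?thesis
    using that by (simp add: orthogonal_matrix_def)
qed

section \<open>Kronecker products, partial traces and core covariance matrices\<close>

lemma sum_UNIV_prod: "(\<Sum>r\<in>UNIV. f r) = (\<Sum>i\<in>UNIV. \<Sum>a\<in>UNIV. f (i, a))"
  for f :: "'n::finite \<times> 'm::finite \<Rightarrow> 'b::comm_monoid_add"
  by (simp add: sum.cartesian_product flip: UNIV_Times_UNIV)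

lemma tr1_nth: "tr1 A $ a $ b = (\<Sum>i\<in>UNIV. A $ (i, a) $ (i, b))"
  by (simp add: tr1_def block_def)

lemma tr2_nth: "tr2 A $ i $ j = (\<Sum>a\<in>UNIV. A $ (i, a) $ (j, a))"
  by (simp add: tr2_def block_def trace_def)

lemma kron_nth: "kron A B $ r $ s = A $ fst r $ fst s * B $ snd r $ snd s"
  by (simp add: kron_def)

lemma kron_mult: "kron A B ** kron C D = kron (A ** C) (B ** D)"
  by (simp add: vec_eq_iff matrix_matrix_mult_def kron_nth sum_UNIV_prod sum_product mult.assoc mult.left_commute)

lemma transpose_kron: "transpose (kron A B) = kron (transpose A) (transpose B)"
  by (simp add: vec_eq_iff transpose_def kron_nth)

lemma kron_mat_1 [simp]: "kron (mat 1) (mat 1) = mat 1"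
  by (auto simp: vec_eq_iff mat_def kron_nth)

lemma kron_diag_mat: "kron (diag_mat d) (diag_mat e) = diag_mat (\<lambda>r. d (fst r) * e (snd r))"
  by (auto simp: vec_eq_iff kron_nth diag_mat_def)

lemma orthogonal_matrix_kron:
  "orthogonal_matrix P \<Longrightarrow> orthogonal_matrix Q \<Longrightarrow> orthogonal_matrix (kron P Q)"
  for P :: "real^'n^'n" and Q :: "real^'m^'m"
  by (simp add: orthogonal_matrix_def transpose_kron kron_mult)

text \<open>The identity factor collapses the sum over index pairs to a sum over one index. With the
  three analogous formulas below, the partial trace identities reduce to exchanging finite
  sums.\<close>

lemma kron_mat_1_left_mult_nth:
  "(kron (mat 1) B ** X) $ r $ s = (\<Sum>c\<in>UNIV. B $ snd r $ c * X $ (fst r, c) $ s)"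
proof -
  have "(\<Sum>c\<in>UNIV. kron (mat 1) B $ r $ (k, c) * X $ (k, c) $ s) =
      (if k = fst r then \<Sum>c\<in>UNIV. B $ snd r $ c * X $ (k, c) $ s else 0)" for k
    by (simp add: kron_nth mat_def)
  then show ?thesis
    by (simp add: matrix_matrix_mult_def sum_UNIV_prod)
qed

lemma kron_mat_1_right_mult_nth:
  "(kron A (mat 1) ** X) $ r $ s = (\<Sum>k\<in>UNIV. A $ fst r $ k * X $ (k, snd r) $ s)"
proof -
  have "(\<Sum>c\<in>UNIV. kron A (mat 1) $ r $ (k, c) * X $ (k, c) $ s) =
      A $ fst r $ k * X $ (k, snd r) $ s" for k
    by (simp add: kron_nth mat_def if_distrib if_distribR cong: if_cong)
  then show ?thesis
    by (simp add: matrix_matrix_mult_def sum_UNIV_prod)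
qed

lemma mult_kron_mat_1_left_nth:
  "(X ** kron (mat 1) B) $ r $ s = (\<Sum>c\<in>UNIV. X $ r $ (fst s, c) * B $ c $ snd s)"
proof -
  have "(\<Sum>c\<in>UNIV. X $ r $ (k, c) * kron (mat 1) B $ (k, c) $ s) =
      (if k = fst s then \<Sum>c\<in>UNIV. X $ r $ (k, c) * B $ c $ snd s else 0)" for k
    by (simp add: kron_nth mat_def)
  then show ?thesis
    by (simp add: matrix_matrix_mult_def sum_UNIV_prod)
qed

lemma mult_kron_mat_1_right_nth:
  "(X ** kron A (mat 1)) $ r $ s = (\<Sum>k\<in>UNIV. X $ r $ (k, snd s) * A $ k $ fst s)"
proof -
  have "(\<Sum>c\<in>UNIV. X $ r $ (k, c) * kron A (mat 1) $ (k, c) $ s) =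
      X $ r $ (k, snd s) * A $ k $ fst s" for k
    by (simp add: kron_nth mat_def if_distrib if_distribR cong: if_cong)
  then show ?thesis
    by (simp add: matrix_matrix_mult_def sum_UNIV_prod)
qed

lemmas kron_mat_1_mult_nth =
  kron_mat_1_left_mult_nth kron_mat_1_right_mult_nth mult_kron_mat_1_left_nth mult_kron_mat_1_right_nth

lemma tr1_kron_mult_left: "tr1 (kron (mat 1) B ** X) = B ** tr1 X"
  unfolding vec_eq_iff tr1_nth kron_mat_1_mult_nth
  by (auto simp: matrix_matrix_mult_def tr1_nth sum_distrib_left intro: sum.swap)

lemma tr1_kron_mult_right: "tr1 (X ** kron (mat 1) B) = tr1 X ** B"
  unfolding vec_eq_iff tr1_nth kron_mat_1_mult_nth
  by (auto simp: matrix_matrix_mult_def tr1_nth sum_distrib_right intro: sum.swap)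

lemma tr2_kron_mult_left: "tr2 (kron A (mat 1) ** X) = A ** tr2 X"
  unfolding vec_eq_iff tr2_nth kron_mat_1_mult_nth
  by (auto simp: matrix_matrix_mult_def tr2_nth sum_distrib_left intro: sum.swap)

lemma tr2_kron_mult_right: "tr2 (X ** kron A (mat 1)) = tr2 X ** A"
  unfolding vec_eq_iff tr2_nth kron_mat_1_mult_nth
  by (auto simp: matrix_matrix_mult_def tr2_nth sum_distrib_right intro: sum.swap)

text \<open>A partial form of the cyclicity of the trace: \<open>tr1\<close> sums over the block
  index, so a factor acting on this index alone may be moved around.\<close>

lemma tr1_kron_commute: "tr1 (kron A (mat 1) ** X) = tr1 (X ** kron A (mat 1))"
  unfolding vec_eq_iff tr1_nth kron_mat_1_mult_nth
  by (auto simp: mult.commute intro: sum.swap)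

lemma tr2_kron_commute: "tr2 (kron (mat 1) B ** X) = tr2 (X ** kron (mat 1) B)"
  unfolding vec_eq_iff tr2_nth kron_mat_1_mult_nth
  by (auto simp: mult.commute intro: sum.swap)

text \<open>Split \<open>kron P Q\<close> into two factors, one for each index. Under
  \<open>tr1\<close> the factor with \<open>P\<close> is cycled and cancels by orthogonality, while
  the one with \<open>Q\<close> comes out of the partial trace.\<close>

lemma tr1_kron_conj:
  assumes "orthogonal_matrix P"
  shows "tr1 (transpose (kron P Q) ** S ** kron P Q) = transpose Q ** tr1 S ** Q"
proof -
  have 1: "kron P Q = kron P (mat 1) ** kron (mat 1) Q"
    by (simp add: kron_mult)
  have 2: "transpose (kron P Q) = kron (mat 1) (transpose Q) ** kron (transpose P) (mat 1)"
    by (simp add: kron_mult transpose_kron)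
  have "tr1 (transpose (kron P Q) ** S ** kron P Q)
      = tr1 (kron (mat 1) (transpose Q) ** (kron (transpose P) (mat 1) ** (S ** kron P (mat 1))) ** kron (mat 1) Q)"
    unfolding 2 by (subst 1) (simp add: matrix_mul_assoc)
  also have "\<dots> = transpose Q ** tr1 (S ** (kron P (mat 1) ** kron (transpose P) (mat 1))) ** Q"
    by (simp only: tr1_kron_mult_left tr1_kron_mult_right tr1_kron_commute matrix_mul_assoc[of S])
  finally show ?thesis
    using assms by (simp add: kron_mult orthogonal_matrix_def)
qed

lemma tr2_kron_conj:
  assumes "orthogonal_matrix Q"
  shows "tr2 (transpose (kron P Q) ** S ** kron P Q) = transpose P ** tr2 S ** P"
proof -
  have 1: "kron P Q = kron (mat 1) Q ** kron P (mat 1)"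
    by (simp add: kron_mult)
  have 2: "transpose (kron P Q) = kron (transpose P) (mat 1) ** kron (mat 1) (transpose Q)"
    by (simp add: kron_mult transpose_kron)
  have "tr2 (transpose (kron P Q) ** S ** kron P Q)
      = tr2 (kron (transpose P) (mat 1) ** (kron (mat 1) (transpose Q) ** (S ** kron (mat 1) Q)) ** kron P (mat 1))"
    unfolding 2 by (subst 1) (simp add: matrix_mul_assoc)
  also have "\<dots> = transpose P ** tr2 (S ** (kron (mat 1) Q ** kron (mat 1) (transpose Q))) ** P"
    by (simp only: tr2_kron_mult_left tr2_kron_mult_right tr2_kron_commute matrix_mul_assoc[of S])
  finally show ?thesis
    using assms by (simp add: kron_mult orthogonal_matrix_def)
qed

section \<open>Spectral form of positive definite matrices\<close>

lemma conj_diag_nth: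
  "(transpose W ** S ** W) $ r $ r = column r W \<bullet> (S *v column r W)"
  for W S :: "real^'k^'k"
proof -
  have "(transpose W ** (S ** W)) $ r $ r = (\<Sum>i\<in>UNIV. W $ i $ r * (S ** W) $ i $ r)"
    by (simp add: matrix_matrix_mult_def transpose_def)
  moreover have "(S ** W) $ i $ r = (S *v column r W) $ i" for i
    by (simp add: matrix_matrix_mult_def column_def matrix_vector_mult_def)
  ultimately show ?thesis
    by (simp add: inner_vec_def column_def matrix_mul_assoc)
qed

lemma spd_conj_diag_pos:
  assumes "S \<in> spd_mats" "orthogonal_matrix W"
  shows "(transpose W ** S ** W) $ r $ r > 0"
proof -
  have "norm (column r W) = 1"
    using assms(2) by (simp add: orthogonal_matrix_orthonormal_columns)
  then have "column r W \<noteq> 0" by auto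
  then show ?thesis
    using assms(1) by (simp add: conj_diag_nth spd_mats_def)
qed

lemma spd_diagonalization:
  assumes "K \<in> spd_mats"
  obtains P d where "orthogonal_matrix P" "\<And>i. d i > 0" "K = P ** diag_mat d ** transpose P"
proof -
  have "K \<in> sym_mats" using assms by (simp add: spd_mats_def)
  then obtain P d where P: "orthogonal_matrix P" "K = P ** diag_mat d ** transpose P"
    by (rule symmetric_matrix_diagonalization)
  have "transpose P ** K ** P = (transpose P ** P) ** diag_mat d ** (transpose P ** P)"
    by (simp add: P(2) matrix_mul_assoc)
  then have "transpose P ** K ** P = diag_mat d"
    using P(1) by (simp add: orthogonal_matrix_def)
  \<comment> \<open>The eigenvalues are diagonal entries of the conjugated matrix, hence values of
    the quadratic form at the columns of \<open>P\<close>.\<close>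
  then have "d i > 0" for i
    using spd_conj_diag_pos[OF assms P(1), of i] by (simp add: diag_mat_def)
  with P that show ?thesis by blast
qed

lemma conj_diag_spd:
  assumes "orthogonal_matrix P" "\<And>i. d i > 0"
  shows "P ** diag_mat d ** transpose P \<in> spd_mats"
proof -
  have "transpose (diag_mat d) = diag_mat d"
    by (auto simp: diag_mat_def transpose_def vec_eq_iff)
  then have "P ** diag_mat d ** transpose P \<in> sym_mats"
    by (simp add: sym_mats_def matrix_transpose_mul matrix_mul_assoc)
  moreover have "x \<bullet> ((P ** diag_mat d ** transpose P) *v x) > 0" if "x \<noteq> 0" for x
  proof -
    define y where "y = transpose P *v x"
    have "P *v y = x"
      using assms(1) by (simp add: y_def matrix_vector_mul_assoc orthogonal_matrix_def del: transpose_matrix_vector)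
    then have "y \<noteq> 0" using that by auto
    then obtain i where i: "y $ i \<noteq> 0" by (auto simp: vec_eq_iff)
    have "(P ** diag_mat d ** transpose P) *v x = P *v (diag_mat d *v y)"
      by (simp add: y_def matrix_vector_mul_assoc matrix_mul_assoc del: transpose_matrix_vector)
    then have "x \<bullet> ((P ** diag_mat d ** transpose P) *v x) = y \<bullet> (diag_mat d *v y)"
      by (simp add: y_def dot_lmul_matrix)
    also have "\<dots> = (\<Sum>i\<in>UNIV. d i * (y $ i)\<^sup>2)"
      by (simp add: inner_vec_def matrix_vector_mult_def diag_mat_def if_distrib if_distribR power2_eq_square mult_ac cong: if_cong)
    also have "\<dots> > 0"
      using assms(2) i by (intro sum_pos2[of _ i]) (auto simp: less_imp_le)
    finally show ?thesis .
  qed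
  ultimately show ?thesis by (simp add: spd_mats_def)
qed

lemma matrix_inv_eqI:
  fixes A B :: "'a::semiring_1^'k^'k"
  assumes "A ** B = mat 1" "B ** A = mat 1"
  shows "matrix_inv A = B"
proof -
  have "A ** matrix_inv A = mat 1 \<and> matrix_inv A ** A = mat 1"
    unfolding matrix_inv_def by (rule someI[of _ B]) (use assms in auto)
  then have "B ** (A ** matrix_inv A) = B" by simp
  then show ?thesis using assms by (simp add: matrix_mul_assoc)
qed

lemma diag_mat_mult: "diag_mat d ** diag_mat e = diag_mat (\<lambda>i. d i * e i)"
  by (simp add: vec_eq_iff diag_matrix_mult) (simp add: diag_mat_def)

lemma diag_mat_1: "diag_mat (\<lambda>_. 1) = mat 1"
  by (simp add: diag_mat_def mat_def)

lemma conj_diag_mult: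
  assumes "orthogonal_matrix W"
  shows "(W ** diag_mat d ** transpose W) ** (W ** diag_mat e ** transpose W)
    = W ** diag_mat (\<lambda>i. d i * e i) ** transpose W"
proof -
  have "(W ** diag_mat d ** transpose W) ** (W ** diag_mat e ** transpose W)
    = W ** diag_mat d ** (transpose W ** W) ** diag_mat e ** transpose W"
    by (simp add: matrix_mul_assoc)
  also have "\<dots> = W ** (diag_mat d ** diag_mat e) ** transpose W"
    using assms by (simp add: orthogonal_matrix_def matrix_mul_assoc)
  finally show ?thesis by (simp add: diag_mat_mult)
qed

lemma matrix_inv_conj_diag:
  assumes "orthogonal_matrix W" "\<And>i. d i \<noteq> 0"
  shows "matrix_inv (W ** diag_mat d ** transpose W) = W ** diag_mat (\<lambda>i. 1 / d i) ** transpose W"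
  using assms by (intro matrix_inv_eqI)
    (simp_all add: conj_diag_mult diag_mat_1, simp_all add: orthogonal_matrix_def)

lemma trace_mult_conj_diag:
  "trace (S ** (W ** diag_mat d ** transpose W)) = (\<Sum>r\<in>UNIV. (transpose W ** S ** W) $ r $ r * d r)"
proof -
  have "trace (S ** (W ** diag_mat d ** transpose W)) = trace ((S ** W ** diag_mat d) ** transpose W)"
    by (simp add: matrix_mul_assoc)
  also have "\<dots> = trace ((transpose W ** S ** W) ** diag_mat d)"
    by (subst trace_mul_sym) (simp add: matrix_mul_assoc)
  finally show ?thesis by (simp add: trace_def matrix_diag_mult)
qed

lemma det_conj_diag:
  assumes "orthogonal_matrix P"
  shows "det (P ** diag_mat d ** transpose P) = (\<Prod>i\<in>UNIV. d i)"
proof -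
  have "det P * det P = det (P ** transpose P)" by (simp add: det_mul)
  then have "det P * det P = 1" using assms by (simp add: orthogonal_matrix_def)
  moreover have "det (diag_mat d) = (\<Prod>i\<in>UNIV. d i)"
    by (subst det_diagonal) (auto simp: diag_mat_def)
  ultimately show ?thesis by (simp add: det_mul)
qed

lemma kron_conj_diag:
  "kron (P ** diag_mat k ** transpose P) (Q ** diag_mat l ** transpose Q)
    = kron P Q ** diag_mat (\<lambda>r. k (fst r) * l (snd r)) ** transpose (kron P Q)"
  by (simp add: transpose_kron kron_mult flip: kron_diag_mat)

section \<open>The Kronecker objective in a joint eigenbasis\<close>

lemma sum_diag_tr2: "(\<Sum>a\<in>UNIV. R $ (i, a) $ (i, a)) = tr2 R $ i $ i"
  by (simp add: tr2_nth)

lemma sum_diag_tr1: "(\<Sum>i\<in>UNIV. R $ (i, a) $ (i, a)) = tr1 R $ a $ a"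
  by (simp add: tr1_nth)

text \<open>In the joint eigenbasis the inverse of the Kronecker product is diagonal, so
  \<open>S\<close> enters only through the diagonal of its conjugate.\<close>

lemma kron_objective_conj_diag:
  fixes P :: "real^'n^'n" and Q :: "real^'m^'m"
  assumes "orthogonal_matrix P" "orthogonal_matrix Q" and pos: "\<And>i. k i > 0" "\<And>a. l a > 0"
  shows "kron_objective S (P ** diag_mat k ** transpose P, Q ** diag_mat l ** transpose Q)
    = (\<Sum>r\<in>UNIV. (transpose (kron P Q) ** S ** kron P Q) $ r $ r / (k (fst r) * l (snd r)))
      + real CARD('m) * (\<Sum>i\<in>UNIV. ln (k i)) + real CARD('n) * (\<Sum>a\<in>UNIV. ln (l a))"
proof -
  have "k i * l a \<noteq> 0" for i a using pos(1)[of i] pos(2)[of a] by simp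
  moreover have "k i \<noteq> 0" "l a \<noteq> 0" for i a using pos(1)[of i] pos(2)[of a] by simp_all
  ultimately show ?thesis
    using assms by (simp add: kron_objective_def kron_conj_diag matrix_inv_conj_diag orthogonal_matrix_kron
        trace_mult_conj_diag det_conj_diag ln_prod)
qed

lemma kron_objective_mat_1: "kron_objective S (mat 1, mat 1) = trace S"
  by (simp add: kron_objective_def matrix_inv_eqI[of "mat 1" "mat 1"])

lemma mat_1_spd: "mat 1 \<in> spd_mats"
  by (simp add: spd_mats_def sym_mats_def)

text \<open>This is \<open>ln y \<le> y - 1\<close> at \<open>y = 1 / x\<close>, where equality
  holds only for \<open>y = 1\<close>.\<close>

lemma ln_inverse_gap: "1 \<le> 1 / x + ln x" "1 / x + ln x = 1 \<Longrightarrow> x = 1" if "x > 0" for x :: real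
proof -
  show "1 \<le> 1 / x + ln x"
    using ln_le_minus_one[of "1 / x"] that by (simp add: ln_div)
  show "x = 1" if "1 / x + ln x = 1"
    using ln_eq_minus_one[of "1 / x"] \<open>x > 0\<close> that by (simp add: ln_div)
qed

lemma trace_conj_orthogonal:
  "orthogonal_matrix W \<Longrightarrow> trace (transpose W ** S ** W) = trace S" for S W :: "real^'k^'k"
  by (simp add: trace_mul_sym[of _ W] matrix_mul_assoc orthogonal_matrix_def)

text \<open>In a joint eigenbasis of \<open>K2\<close> and \<open>K1\<close> the partial trace conditions turn the
  log-determinants into sums with the same weights as the trace term, so that
  \<open>1 / x + ln x \<ge> 1\<close> can be applied summand by summand.\<close>

lemma kron_objective_ge:
  fixes S :: "('n::finite, 'm::finite) bmat"
  assumes S: "S \<in> spd_mats" "tr1 S = real CARD('n) *\<^sub>R mat 1" "tr2 S = real CARD('m) *\<^sub>R mat 1"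
    and K: "K2 \<in> spd_mats" "K1 \<in> spd_mats"
  shows "trace S \<le> kron_objective S (K2, K1)"
    and "kron_objective S (K2, K1) = trace S \<Longrightarrow> kron K2 K1 = mat 1"
proof -
  obtain P k where P: "orthogonal_matrix P" "\<And>i. k i > 0" "K2 = P ** diag_mat k ** transpose P"
    using spd_diagonalization[OF K(1)] by metis
  obtain Q l where Q: "orthogonal_matrix Q" "\<And>i. l i > 0" "K1 = Q ** diag_mat l ** transpose Q"
    using spd_diagonalization[OF K(2)] by metis
  define R where "R = transpose (kron P Q) ** S ** kron P Q"
  define x where "x = (\<lambda>r. k (fst r) * l (snd r))"
  have x: "x r > 0" for r using P Q by (simp add: x_def)
  have R: "R $ r $ r > 0" for r
    unfolding R_def by (intro spd_conj_diag_pos S orthogonal_matrix_kron P Q)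
  have tr: "trace S = (\<Sum>r\<in>UNIV. R $ r $ r)"
    unfolding R_def trace_def[symmetric] by (intro trace_conj_orthogonal[symmetric] orthogonal_matrix_kron P Q)
  have "tr2 R = real CARD('m) *\<^sub>R mat 1"
    using P(1) Q(1) by (simp add: R_def tr2_kron_conj S(3) orthogonal_matrix_def matrix_scalar_ac flip: scalar_matrix_assoc)
  then have R2: "(\<Sum>a\<in>UNIV. R $ (i, a) $ (i, a)) = real CARD('m)" for i
    by (simp add: sum_diag_tr2 mat_def)
  have "tr1 R = real CARD('n) *\<^sub>R mat 1"
    using P(1) Q(1) by (simp add: R_def tr1_kron_conj S(2) orthogonal_matrix_def
        matrix_scalar_ac flip: scalar_matrix_assoc)
  then have R1: "(\<Sum>i\<in>UNIV. R $ (i, a) $ (i, a)) = real CARD('n)" for a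
    by (simp add: sum_diag_tr1 mat_def)
  have "real CARD('m) * (\<Sum>i\<in>UNIV. ln (k i)) = (\<Sum>r\<in>UNIV. R $ r $ r * ln (k (fst r)))"
    by (simp add: sum_UNIV_prod R2 sum_distrib_left flip: sum_distrib_right)
  moreover have "real CARD('n) * (\<Sum>a\<in>UNIV. ln (l a)) = (\<Sum>r\<in>UNIV. R $ r $ r * ln (l (snd r)))"
    unfolding sum_UNIV_prod
    by (subst sum.swap) (simp add: R1 sum_distrib_left flip: sum_distrib_right)
  moreover have "ln (x r) = ln (k (fst r)) + ln (l (snd r))" for r
    unfolding x_def using P(2) Q(2) by (simp add: ln_mult_pos)
  ultimately have obj: "kron_objective S (K2, K1) = (\<Sum>r\<in>UNIV. R $ r $ r * (1 / x r + ln (x r)))"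
    using P Q by (simp add: kron_objective_conj_diag R_def distrib_left sum.distrib add_ac)
       (simp add: x_def)
  have le: "R $ r $ r \<le> R $ r $ r * (1 / x r + ln (x r))" for r
    using mult_left_mono[OF ln_inverse_gap(1)[OF x[of r]], of "R $ r $ r"] R[of r] by simp
  show "trace S \<le> kron_objective S (K2, K1)"
    unfolding obj tr by (intro sum_mono le)
  assume "kron_objective S (K2, K1) = trace S"
  \<comment> \<open>Equality of the sums forces equality in every term of \<open>le\<close>. Since
    the weights \<open>R $ r $ r\<close> are strictly positive, each \<open>x r\<close> is then the
    equality case of the scalar inequality.\<close>
  then have "(\<Sum>r\<in>UNIV. R $ r $ r * (1 / x r + ln (x r)) - R $ r $ r) = 0"
    unfolding obj tr by (simp add: sum_subtractf)
  then have eq: "\<forall>r\<in>UNIV. R $ r $ r * (1 / x r + ln (x r)) - R $ r $ r = 0"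
    using le by (subst (asm) sum_nonneg_eq_0_iff) simp_all
  have "1 / x r + ln (x r) = 1" for r
  proof -
    have "R $ r $ r * (1 / x r + ln (x r)) = R $ r $ r * 1"
      using bspec[OF eq UNIV_I, of r] by simp
    then show ?thesis using R[of r] by (simp only: mult_cancel_left) simp
  qed
  then have "x = (\<lambda>_. 1)"
    using ln_inverse_gap(2)[OF x] by blast
  then show "kron K2 K1 = mat 1"
    using orthogonal_matrix_kron[OF P(1) Q(1)]
    by (simp add: P(3) Q(3) kron_conj_diag x_def[symmetric] diag_mat_1 orthogonal_matrix_def)
qed

section \<open>Necessity of the partial trace conditions\<close>

lemma diag_mat_const: "diag_mat (\<lambda>_. c) = c *\<^sub>R mat 1"
  by (auto simp: diag_mat_def mat_def vec_eq_iff)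

text \<open>At \<open>x = 1\<close> the right-hand side equals \<open>s\<close>, so 1 is an interior
  minimum and the derivative \<open>c - s\<close> vanishes there. This is applied to the objective
  as a function of one eigenvalue.\<close>

lemma inverse_plus_ln_minimal_at_1:
  fixes s c :: real
  assumes "\<And>x. x > 0 \<Longrightarrow> s \<le> s / x + c * ln x"
  shows "s = c"
proof -
  have "((\<lambda>x. s / x + c * ln x) has_real_derivative (c - s)) (at 1)"
    by (auto intro!: derivative_eq_intros)
  moreover have "\<forall>y. \<bar>1 - y\<bar> < 1 \<longrightarrow> s / 1 + c * ln 1 \<le> s / y + c * ln y"
    using assms by auto
  ultimately have "c - s = 0"
    by (rule DERIV_local_min[OF _ zero_less_one])
  then show ?thesis by simp
qed

lemma transpose_tr1: "transpose (tr1 S) = tr1 (transpose S)"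
  by (simp add: vec_eq_iff transpose_def tr1_nth)

lemma transpose_tr2: "transpose (tr2 S) = tr2 (transpose S)"
  by (simp add: vec_eq_iff transpose_def tr2_nth)

text \<open>In an eigenbasis of \<open>tr2 S\<close>, keep the second factor equal to the identity
  and let one eigenvalue \<open>x\<close> of the first vary. Up to constants the objective is
  \<open>s i / x + real CARD('m) * ln x\<close>, and minimality at \<open>x = 1\<close> determines
  \<open>s i\<close>.\<close>

lemma tr2_of_minimal:
  fixes S :: "('n::finite, 'm::finite) bmat"
  assumes S: "S \<in> sym_mats"
    and min: "\<And>K2 K1. K2 \<in> spd_mats \<Longrightarrow> K1 \<in> spd_mats \<Longrightarrow> trace S \<le> kron_objective S (K2, K1)"
  shows "tr2 S = real CARD('m) *\<^sub>R mat 1"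
proof -
  have "tr2 S \<in> sym_mats" using S by (simp add: sym_mats_def transpose_tr2)
  then obtain P s where P: "orthogonal_matrix P" "tr2 S = P ** diag_mat s ** transpose P"
    by (rule symmetric_matrix_diagonalization)
  let ?I = "mat 1 :: real^'m^'m"
  define R where "R = transpose (kron P ?I) ** S ** kron P ?I"
  have tr: "trace S = (\<Sum>r\<in>UNIV. R $ r $ r)"
    unfolding R_def trace_def[symmetric] by (intro trace_conj_orthogonal[symmetric] orthogonal_matrix_kron P orthogonal_matrix_id)
  have "tr2 R = (transpose P ** P) ** diag_mat s ** (transpose P ** P)"
    by (simp add: R_def tr2_kron_conj orthogonal_matrix_id P(2) matrix_mul_assoc)
  then have "tr2 R = diag_mat s" using P by (simp add: orthogonal_matrix_def)
  then have Rs: "(\<Sum>a\<in>UNIV. R $ (i, a) $ (i, a)) = s i" for i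
    by (simp add: sum_diag_tr2 diag_mat_def)
  have "s i = real CARD('m)" for i
  proof (rule inverse_plus_ln_minimal_at_1)
    fix x :: real assume x: "x > 0"
    define k where "k = (\<lambda>_. 1)(i := x)"
    have k: "k j > 0" for j using x by (simp add: k_def)
    have "trace S \<le> kron_objective S (P ** diag_mat k ** transpose P, ?I ** diag_mat (\<lambda>_. 1) ** transpose ?I)"
      by (intro min conj_diag_spd P orthogonal_matrix_id k) simp
    also have "\<dots> = (\<Sum>j\<in>UNIV. s j / k j) + real CARD('m) * (\<Sum>j\<in>UNIV. ln (k j))"
      by (subst kron_objective_conj_diag)
        (simp_all add: P orthogonal_matrix_id k sum_UNIV_prod Rs flip: R_def sum_divide_distrib)
    finally have "(\<Sum>j\<in>UNIV. s j) \<le> (\<Sum>j\<in>UNIV. s j / k j) + real CARD('m) * (\<Sum>j\<in>UNIV. ln (k j))"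
      by (simp add: tr sum_UNIV_prod Rs)
    moreover have "(\<Sum>j\<in>UNIV. s j) = s i + (\<Sum>j\<in>UNIV - {i}. s j)"
      by (simp add: sum.remove)
    moreover have "(\<Sum>j\<in>UNIV. s j / k j) = s i / x + (\<Sum>j\<in>UNIV - {i}. s j)"
      by (simp add: sum.remove[of _ i] k_def)
    moreover have "(\<Sum>j\<in>UNIV. ln (k j)) = ln x"
      by (simp add: sum.remove[of _ i] k_def)
    ultimately show "s i \<le> s i / x + real CARD('m) * ln x" by simp
  qed
  then have "s = (\<lambda>_. real CARD('m))" by blast
  then show ?thesis
    using P by (simp add: diag_mat_const orthogonal_matrix_def matrix_scalar_ac flip: scalar_matrix_assoc)
qed

text \<open>Mirror image of the argument for \<open>tr2\<close>: the varying eigenvalue now belongs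
  to the second factor.\<close>

lemma tr1_of_minimal:
  fixes S :: "('n::finite, 'm::finite) bmat"
  assumes S: "S \<in> sym_mats"
    and min: "\<And>K2 K1. K2 \<in> spd_mats \<Longrightarrow> K1 \<in> spd_mats \<Longrightarrow> trace S \<le> kron_objective S (K2, K1)"
  shows "tr1 S = real CARD('n) *\<^sub>R mat 1"
proof -
  have "tr1 S \<in> sym_mats" using S by (simp add: sym_mats_def transpose_tr1)
  then obtain Q s where Q: "orthogonal_matrix Q" "tr1 S = Q ** diag_mat s ** transpose Q"
    by (rule symmetric_matrix_diagonalization)
  let ?I = "mat 1 :: real^'n^'n"
  define R where "R = transpose (kron ?I Q) ** S ** kron ?I Q"
  have tr: "trace S = (\<Sum>r\<in>UNIV. R $ r $ r)"
    unfolding R_def trace_def[symmetric] by (intro trace_conj_orthogonal[symmetric] orthogonal_matrix_kron Q orthogonal_matrix_id)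
  have "tr1 R = (transpose Q ** Q) ** diag_mat s ** (transpose Q ** Q)"
    by (simp add: R_def tr1_kron_conj orthogonal_matrix_id Q(2) matrix_mul_assoc)
  then have "tr1 R = diag_mat s" using Q by (simp add: orthogonal_matrix_def)
  then have Rs: "(\<Sum>i\<in>UNIV. R $ (i, a) $ (i, a)) = s a" for a
    by (simp add: sum_diag_tr1 diag_mat_def)
  \<comment> \<open>Expanding a sum over index pairs puts the sum over blocks outside, whereas
    \<open>Rs\<close> needs it inside.\<close>
  have swap: "(\<Sum>r\<in>UNIV. f r) = (\<Sum>a\<in>UNIV. \<Sum>i\<in>UNIV. f (i, a))" for f :: "'n \<times> 'm \<Rightarrow> real"
    unfolding sum_UNIV_prod by (rule sum.swap)
  have "s a = real CARD('n)" for a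
  proof (rule inverse_plus_ln_minimal_at_1)
    fix x :: real assume x: "x > 0"
    define k where "k = (\<lambda>_. 1)(a := x)"
    have k: "k j > 0" for j using x by (simp add: k_def)
    have "trace S \<le> kron_objective S (?I ** diag_mat (\<lambda>_. 1) ** transpose ?I, Q ** diag_mat k ** transpose Q)"
      by (intro min conj_diag_spd Q orthogonal_matrix_id k) simp
    also have "\<dots> = (\<Sum>j\<in>UNIV. s j / k j) + real CARD('n) * (\<Sum>j\<in>UNIV. ln (k j))"
      by (subst kron_objective_conj_diag)
        (simp_all add: Q orthogonal_matrix_id k swap Rs flip: R_def sum_divide_distrib)
    finally have "(\<Sum>j\<in>UNIV. s j) \<le> (\<Sum>j\<in>UNIV. s j / k j) + real CARD('n) * (\<Sum>j\<in>UNIV. ln (k j))"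
      by (simp add: tr swap Rs)
    moreover have "(\<Sum>j\<in>UNIV. s j) = s a + (\<Sum>j\<in>UNIV - {a}. s j)"
      by (simp add: sum.remove)
    moreover have "(\<Sum>j\<in>UNIV. s j / k j) = s a / x + (\<Sum>j\<in>UNIV - {a}. s j)"
      by (simp add: sum.remove[of _ a] k_def)
    moreover have "(\<Sum>j\<in>UNIV. ln (k j)) = ln x"
      by (simp add: sum.remove[of _ a] k_def)
    ultimately show "s a \<le> s a / x + real CARD('n) * ln x" by simp
  qed
  then have "s = (\<lambda>_. real CARD('n))" by blast
  then show ?thesis
    using Q by (simp add: diag_mat_const orthogonal_matrix_def matrix_scalar_ac flip: scalar_matrix_assoc)
qed

text \<open>A minimizer is known only through its Kronecker product, while the objective sees the
  two factors. If the product is the identity, the factors are \<open>1 / c\<close> and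
  \<open>c\<close> times identities, and the logarithms cancel because each determinant is weighted
  by the size of the other factor.\<close>

lemma kron_eq_mat_1_objective:
  fixes S :: "('n::finite, 'm::finite) bmat"
  assumes K: "K2 \<in> spd_mats" "K1 \<in> spd_mats" "kron K2 K1 = mat 1"
  shows "kron_objective S (K2, K1) = trace S"
proof -
  fix a0 :: 'm and i0 :: 'n
  define c where "c = K1 $ a0 $ a0"
  have e: "K2 $ i $ j * K1 $ a $ b = (if i = j \<and> a = b then 1 else 0)" for i j a b
    using arg_cong[OF K(3), of "\<lambda>M. M $ (i, a) $ (j, b)"] by (simp add: kron_nth mat_def)
  have c: "c > 0"
    using spd_conj_diag_pos[OF K(2) orthogonal_matrix_id, of a0] by (simp add: c_def)
  have "K2 $ i $ j = (if i = j then 1 / c else 0)" for i j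
    using e[of i j a0 a0] c by (simp add: c_def field_simps split: if_splits)
  then have K2: "K2 = mat 1 ** diag_mat (\<lambda>_. 1 / c) ** transpose (mat 1)"
    by (simp add: diag_mat_def vec_eq_iff)
  have "K1 $ a $ b = (if a = b then c else 0)" for a b
    using e[of i0 i0 a b] e[of i0 i0 a0 a0] c
    by (auto simp: c_def split: if_splits) (metis mult_cancel_left zero_neq_one mult_zero_left)+
  then have K1: "K1 = mat 1 ** diag_mat (\<lambda>_. c) ** transpose (mat 1)"
    by (simp add: diag_mat_def vec_eq_iff)
  show ?thesis
    unfolding K1 K2 using c
    by (subst kron_objective_conj_diag) (simp_all add: orthogonal_matrix_id ln_div trace_def)
qed

theorem core_covs_eq:
  "(core_covs :: ('n::finite, 'm::finite) bmat set) =
    {C \<in> spd_mats. tr1 C = real CARD('n) *\<^sub>R mat 1 \<and> tr2 C = real CARD('m) *\<^sub>R mat 1}"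
proof (intro set_eqI iffI)
  fix C :: "('n, 'm) bmat"
  assume "C \<in> core_covs"
  then have C: "C \<in> spd_mats" "is_k C (mat 1)" by (auto simp: core_covs_def)
  then obtain L2 L1 where L: "kron L2 L1 = (mat 1 :: ('n, 'm) bmat)"
    "is_arg_min (kron_objective C) (\<lambda>z. z \<in> spd_mats \<times> spd_mats) (L2, L1)"
    unfolding is_k_def by (smt (verit) mem_Collect_eq singletonI)
  have "trace C \<le> kron_objective C (K2, K1)" if "K2 \<in> spd_mats" "K1 \<in> spd_mats" for K2 K1
  proof -
    \<comment> \<open>\<open>is_k\<close> gives minimality at some pair whose product is the
      identity, not necessarily at the pair of identities; the value there is the trace all the
      same.\<close>
    have "trace C = kron_objective C (L2, L1)"
      using L by (simp add: kron_eq_mat_1_objective is_arg_min_def)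
    then show ?thesis using L(2) that by (force simp: is_arg_min_def)
  qed
  moreover have "C \<in> sym_mats" using C by (simp add: spd_mats_def)
  ultimately show "C \<in> {C \<in> spd_mats. tr1 C = real CARD('n) *\<^sub>R mat 1 \<and> tr2 C = real CARD('m) *\<^sub>R mat 1}"
    using C tr1_of_minimal tr2_of_minimal by blast
next
  fix C :: "('n, 'm) bmat"
  assume "C \<in> {C \<in> spd_mats. tr1 C = real CARD('n) *\<^sub>R mat 1 \<and> tr2 C = real CARD('m) *\<^sub>R mat 1}"
  then have C: "C \<in> spd_mats" "tr1 C = real CARD('n) *\<^sub>R mat 1" "tr2 C = real CARD('m) *\<^sub>R mat 1"
    by auto
  let ?min = "\<lambda>z. is_arg_min (kron_objective C) (\<lambda>z. z \<in> spd_mats \<times> spd_mats) z"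
  have 1: "?min (mat 1, mat 1)"
    using kron_objective_ge(1)[OF C] by (force simp: is_arg_min_def kron_objective_mat_1 mat_1_spd)
  have 2: "kron K2 K1 = mat 1" if "?min (K2, K1)" for K2 K1
  proof (rule kron_objective_ge(2)[OF C])
    show K: "K2 \<in> spd_mats" "K1 \<in> spd_mats"
      using that by (auto simp: is_arg_min_def)
    have "\<not> kron_objective C (mat 1, mat 1) < kron_objective C (K2, K1)"
      using that by (auto simp: is_arg_min_def mat_1_spd)
    then show "kron_objective C (K2, K1) = trace C"
      using kron_objective_ge(1)[OF C K] by (simp add: kron_objective_mat_1)
  qed
  have "is_k C (mat 1)"
    unfolding is_k_def using 1 2 by (auto intro!: exI[of _ "mat 1"])
  with C show "C \<in> core_covs" by (simp add: core_covs_def)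
qed

section \<open>Smooth maps and the symmetry of second derivatives\<close>

lemma Ck_on_cong: "(\<And>x. x \<in> S \<Longrightarrow> f x = g x) \<Longrightarrow> Ck_on k S f \<longleftrightarrow> Ck_on k S g"
proof (cases k)
  case (Suc n)
  assume "\<And>x. x \<in> S \<Longrightarrow> f x = g x"
  then have "(f has_derivative f') (at x within S) \<longleftrightarrow> (g has_derivative f') (at x within S)"
    if "x \<in> S" for f' x
    using that by (auto elim!: has_derivative_transform[rotated 2])
  then show ?thesis by (simp add: Suc)
qed (simp cong: continuous_on_cong)

lemma Ck_on_subset: "Ck_on k S f \<Longrightarrow> T \<subseteq> S \<Longrightarrow> Ck_on k T f"
proof (induction k arbitrary: f)
  case (Suc k)
  then obtain f' where "\<forall>x\<in>S. (f has_derivative f' x) (at x within S)" "\<forall>v. Ck_on k S (\<lambda>x. f' x v)"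
    by auto
  with Suc show ?case
    by (auto intro!: exI[of _ f'] intro: has_derivative_subset)
qed (auto intro: continuous_on_subset)

lemma Ck_on_Suc_imp: "Ck_on (Suc k) S f \<Longrightarrow> Ck_on k S f"
proof (induction k arbitrary: f)
  case 0
  then show ?case by (auto intro: has_derivative_continuous_on)
next
  case (Suc k)
  from Suc.prems obtain f' where "\<forall>x\<in>S. (f has_derivative f' x) (at x within S)"
      "\<forall>v. Ck_on (Suc k) S (\<lambda>x. f' x v)"
    unfolding Ck_on.simps(2)[of "Suc k"] by blast
  then show ?case
    using Suc.IH by (auto simp del: Ck_on.simps(2) simp: Ck_on.simps(2)[of k])
qed

lemma Ck_on_const: "Ck_on k S (\<lambda>_. c)"
proof (induction k arbitrary: c)
  case (Suc k)
  then show ?case by (auto intro!: exI[of _ "\<lambda>_ _. 0"])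
qed simp

lemma Ck_on_ident: "Ck_on k S (\<lambda>x. x)"
proof (cases k)
  case (Suc n)
  then show ?thesis by (auto intro!: exI[of _ "\<lambda>_ v. v"] Ck_on_const)
qed simp

lemma Ck_on_linear: "bounded_linear L \<Longrightarrow> Ck_on k S f \<Longrightarrow> Ck_on k S (\<lambda>x. L (f x))"
proof (induction k arbitrary: f)
  case (Suc k)
  then obtain f' where "\<forall>x\<in>S. (f has_derivative f' x) (at x within S)" "\<forall>v. Ck_on k S (\<lambda>x. f' x v)"
    by auto
  with Suc show ?case
    by (auto intro!: exI[of _ "\<lambda>x v. L (f' x v)"] intro: bounded_linear.has_derivative)
qed (auto intro: bounded_linear.continuous_on)

lemma Ck_on_add: "Ck_on k S f \<Longrightarrow> Ck_on k S g \<Longrightarrow> Ck_on k S (\<lambda>x. f x + g x)"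
proof (induction k arbitrary: f g)
  case (Suc k)
  obtain f' where "\<forall>x\<in>S. (f has_derivative f' x) (at x within S)" "\<forall>v. Ck_on k S (\<lambda>x. f' x v)"
    using Suc.prems by auto
  moreover obtain g' where "\<forall>x\<in>S. (g has_derivative g' x) (at x within S)" "\<forall>v. Ck_on k S (\<lambda>x. g' x v)"
    using Suc.prems by auto
  ultimately show ?case
    using Suc.IH by (auto intro!: exI[of _ "\<lambda>x v. f' x v + g' x v"] intro: has_derivative_add)
qed (auto intro: continuous_on_add)

text \<open>Each term of the product rule pairs a derivative with an undifferentiated factor. The
  induction hypothesis wants order \<open>k\<close> from both, so \<open>Ck_on_Suc_imp\<close>
  lowers the order of the latter.\<close>

lemma Ck_on_bilinear:
  assumes "bounded_bilinear p"
  shows "Ck_on k S f \<Longrightarrow> Ck_on k S g \<Longrightarrow> Ck_on k S (\<lambda>x. p (f x) (g x))"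
proof (induction k arbitrary: f g)
  case (Suc k)
  obtain f' where f': "\<forall>x\<in>S. (f has_derivative f' x) (at x within S)" "\<forall>v. Ck_on k S (\<lambda>x. f' x v)"
    using Suc.prems by auto
  obtain g' where g': "\<forall>x\<in>S. (g has_derivative g' x) (at x within S)" "\<forall>v. Ck_on k S (\<lambda>x. g' x v)"
    using Suc.prems by auto
  have "Ck_on k S (\<lambda>x. p (f x) (g' x v) + p (f' x v) (g x))" for v
    by (intro Ck_on_add Suc.IH Ck_on_Suc_imp[OF Suc.prems(1)] Ck_on_Suc_imp[OF Suc.prems(2)])
      (use f' g' in blast)+
  moreover have "\<forall>x\<in>S. ((\<lambda>x. p (f x) (g x)) has_derivative (\<lambda>v. p (f x) (g' x v) + p (f' x v) (g x))) (at x within S)"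
    using f'(1) g'(1) bounded_bilinear.FDERIV[OF assms] by blast
  ultimately show ?case
    by (auto intro!: exI[of _ "\<lambda>x v. p (f x) (g' x v) + p (f' x v) (g x)"])
qed (auto intro: bounded_bilinear.continuous_on assms)

lemma smooth_on_cong: "smooth_on S f \<Longrightarrow> (\<And>x. x \<in> S \<Longrightarrow> f x = g x) \<Longrightarrow> smooth_on S g"
  using Ck_on_cong[of S f g] by (auto simp: smooth_on_def)

lemma smooth_on_subset: "smooth_on S f \<Longrightarrow> T \<subseteq> S \<Longrightarrow> smooth_on T f"
  by (auto simp: smooth_on_def intro: Ck_on_subset)

lemma smooth_on_const: "smooth_on S (\<lambda>_. c)"
  by (simp add: smooth_on_def Ck_on_const)

lemma smooth_on_ident: "smooth_on S (\<lambda>x. x)"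
  by (simp add: smooth_on_def Ck_on_ident)

lemma smooth_on_linear: "bounded_linear L \<Longrightarrow> smooth_on S f \<Longrightarrow> smooth_on S (\<lambda>x. L (f x))"
  by (simp add: smooth_on_def Ck_on_linear)

lemma smooth_on_add: "smooth_on S f \<Longrightarrow> smooth_on S g \<Longrightarrow> smooth_on S (\<lambda>x. f x + g x)"
  by (simp add: smooth_on_def Ck_on_add)

lemma smooth_on_bilinear:
  "bounded_bilinear p \<Longrightarrow> smooth_on S f \<Longrightarrow> smooth_on S g \<Longrightarrow> smooth_on S (\<lambda>x. p (f x) (g x))"
  by (simp add: smooth_on_def Ck_on_bilinear)

lemma smooth_on_sum:
  "(\<And>i. i \<in> I \<Longrightarrow> smooth_on S (f i)) \<Longrightarrow> smooth_on S (\<lambda>x. \<Sum>i\<in>I. f i x)"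
  by (induction I rule: infinite_finite_induct) (auto intro: smooth_on_const smooth_on_add)

text \<open>\<open>Ck_on\<close> may supply a different derivative family for each order. On an open
  set derivatives are unique, so all of them agree with the Frechet derivative and one family serves
  every order.\<close>

lemma smooth_on_open_derivative:
  assumes "open S" "smooth_on S f"
  obtains f' where "\<And>x. x \<in> S \<Longrightarrow> (f has_derivative f' x) (at x)" "\<And>v. smooth_on S (\<lambda>x. f' x v)"
proof
  define f' where "f' = (\<lambda>x. frechet_derivative f (at x))"
  have *: "(\<forall>x\<in>S. (f has_derivative f' x) (at x)) \<and> (\<forall>v. Ck_on k S (\<lambda>x. f' x v))" for k
  proof -
    have "Ck_on (Suc k) S f" using assms by (simp add: smooth_on_def)
    then obtain g where g: "\<And>x. x \<in> S \<Longrightarrow> (f has_derivative g x) (at x)" "\<And>v. Ck_on k S (\<lambda>x. g x v)"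
      using at_within_open[OF _ assms(1)] by auto
    then have "g x = f' x" if "x \<in> S" for x
      using that by (auto simp: f'_def intro: frechet_derivative_at)
    with g Ck_on_cong[of S "\<lambda>x. f' x _" "\<lambda>x. g x _"] show ?thesis by auto
  qed
  show "\<And>x. x \<in> S \<Longrightarrow> (f has_derivative f' x) (at x)" using * by blast
  show "\<And>v. smooth_on S (\<lambda>x. f' x v)" using * by (auto simp: smooth_on_def)
qed

section \<open>Symmetry of second derivatives\<close>

lemma has_vector_derivative_line:
  assumes "(f has_derivative f') (at (a + s *\<^sub>R v))"
  shows "((\<lambda>t. f (a + t *\<^sub>R v)) has_vector_derivative f' v) (at s)"
proof -
  interpret f': bounded_linear f' using assms by (rule has_derivative_bounded_linear)
  have "((\<lambda>t. a + t *\<^sub>R v) has_derivative (\<lambda>t. t *\<^sub>R v)) (at s)"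
    by (auto intro!: derivative_eq_intros)
  from has_derivative_compose[OF this assms] show ?thesis
    by (simp add: has_vector_derivative_def f'.scaleR)
qed

text \<open>The mean value theorem is applied first along \<open>v\<close>, then along
  \<open>w\<close>. The second difference itself is symmetric in \<open>v\<close> and
  \<open>w\<close>, which makes the two mixed derivatives comparable.\<close>

lemma mixed_second_difference:
  fixes f :: "'a::real_normed_vector \<Rightarrow> real"
  assumes "h > 0"
    and f: "\<And>s t. 0 \<le> s \<Longrightarrow> s \<le> h \<Longrightarrow> 0 \<le> t \<Longrightarrow> t \<le> h \<Longrightarrow>
      (f has_derivative f' (x + t *\<^sub>R w + s *\<^sub>R v)) (at (x + t *\<^sub>R w + s *\<^sub>R v))"
    and A: "\<And>s t. 0 \<le> s \<Longrightarrow> s \<le> h \<Longrightarrow> 0 \<le> t \<Longrightarrow> t \<le> h \<Longrightarrow>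
      ((\<lambda>y. f' y v) has_derivative A (x + t *\<^sub>R w + s *\<^sub>R v)) (at (x + t *\<^sub>R w + s *\<^sub>R v))"
  obtains s t where "0 \<le> s" "s \<le> h" "0 \<le> t" "t \<le> h"
    "f (x + h *\<^sub>R w + h *\<^sub>R v) - f (x + h *\<^sub>R v) - (f (x + h *\<^sub>R w) - f x)
      = h * (h * A (x + t *\<^sub>R w + s *\<^sub>R v) w)"
proof -
  \<comment> \<open>The term \<open>0 *\<^sub>R w\<close> brings the second point into the shape of
    the hypotheses, with \<open>t = 0\<close>.\<close>
  define g where "g = (\<lambda>s. f (x + h *\<^sub>R w + s *\<^sub>R v) - f (x + 0 *\<^sub>R w + s *\<^sub>R v))"
  have "(g has_real_derivative f' (x + h *\<^sub>R w + s *\<^sub>R v) v - f' (x + 0 *\<^sub>R w + s *\<^sub>R v) v) (at s)"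
    if "0 \<le> s" "s \<le> h" for s
    unfolding g_def has_real_derivative_iff_has_vector_derivative
    using that \<open>h > 0\<close>
    by (intro has_vector_derivative_diff has_vector_derivative_line f) auto
  from MVT2[OF \<open>h > 0\<close> this] obtain s where s: "0 < s" "s < h"
    "g h - g 0 = h * (f' (x + h *\<^sub>R w + s *\<^sub>R v) v - f' (x + 0 *\<^sub>R w + s *\<^sub>R v) v)"
    by auto
  have eq: "x + t *\<^sub>R w + s *\<^sub>R v = x + s *\<^sub>R v + t *\<^sub>R w" for t by simp
  have "((\<lambda>t. f' (x + t *\<^sub>R w + s *\<^sub>R v) v) has_real_derivative A (x + t *\<^sub>R w + s *\<^sub>R v) w) (at t)"
    if "0 \<le> t" "t \<le> h" for t
    using A[of s t] s that has_vector_derivative_line[of "\<lambda>y. f' y v" _ "x + s *\<^sub>R v" t w]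
    unfolding has_real_derivative_iff_has_vector_derivative eq by simp
  from MVT2[OF \<open>h > 0\<close> this] obtain t where t: "0 < t" "t < h"
    "f' (x + h *\<^sub>R w + s *\<^sub>R v) v - f' (x + 0 *\<^sub>R w + s *\<^sub>R v) v = h * A (x + t *\<^sub>R w + s *\<^sub>R v) w"
    by auto
  from s t that[of s t] show ?thesis by (simp add: g_def)
qed

text \<open>One and the same second difference, divided by the square of \<open>h\<close>, is a
  value of either mixed derivative at some point near \<open>x\<close>. Continuity of both excludes
  a gap between their values at \<open>x\<close>.\<close>

lemma second_derivative_symmetric:
  fixes f :: "'a::euclidean_space \<Rightarrow> real"
  assumes U: "open U" "x \<in> U"
    and f: "\<And>y. y \<in> U \<Longrightarrow> (f has_derivative f' y) (at y)"
    and sm: "\<And>v. smooth_on U (\<lambda>y. f' y v)"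
    and A: "((\<lambda>y. f' y v) has_derivative A) (at x)"
    and B: "((\<lambda>y. f' y w) has_derivative B) (at x)"
  shows "A w = B v"
proof (rule ccontr)
  obtain A' where A': "\<And>y. y \<in> U \<Longrightarrow> ((\<lambda>y. f' y v) has_derivative A' y) (at y)" "\<And>z. smooth_on U (\<lambda>y. A' y z)"
    using smooth_on_open_derivative[OF U(1) sm] by blast
  obtain B' where B': "\<And>y. y \<in> U \<Longrightarrow> ((\<lambda>y. f' y w) has_derivative B' y) (at y)" "\<And>z. smooth_on U (\<lambda>y. B' y z)"
    using smooth_on_open_derivative[OF U(1) sm] by blast
  have AB: "A' x = A" "B' x = B"
    using A'(1)[OF U(2)] B'(1)[OF U(2)] A B has_derivative_unique by blast+
  assume "A w \<noteq> B v"
  define \<epsilon> where "\<epsilon> = dist (A w) (B v) / 2"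
  have \<epsilon>: "\<epsilon> > 0" using \<open>A w \<noteq> B v\<close> by (simp add: \<epsilon>_def)
  have "continuous_on U (\<lambda>y. A' y w)" "continuous_on U (\<lambda>y. B' y v)"
    using A'(2)[of w] B'(2)[of v] unfolding smooth_on_def by (metis Ck_on.simps(1))+
  then have "isCont (\<lambda>y. A' y w) x" "isCont (\<lambda>y. B' y v) x"
    using U by (auto simp: continuous_on_eq_continuous_at)
  then have "\<forall>\<^sub>F y in nhds x. dist (A' y w) (A' x w) < \<epsilon>" "\<forall>\<^sub>F y in nhds x. dist (B' y v) (B' x v) < \<epsilon>"
    using \<epsilon> unfolding isCont_def tendsto_iff by (auto simp: eventually_nhds_conv_at)
  moreover have "\<forall>\<^sub>F y in nhds x. y \<in> U"
    using U by (rule eventually_nhds_in_open)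
  ultimately have "\<forall>\<^sub>F y in nhds x. y \<in> U \<and> dist (A' y w) (A' x w) < \<epsilon> \<and> dist (B' y v) (B' x v) < \<epsilon>"
    by eventually_elim simp
  then obtain d where d: "d > 0" and near: "\<And>y. dist y x < d \<Longrightarrow>
      y \<in> U \<and> dist (A' y w) (A' x w) < \<epsilon> \<and> dist (B' y v) (B' x v) < \<epsilon>"
    unfolding eventually_nhds_metric by blast
  \<comment> \<open>With this size the whole parallelogram spanned by \<open>h *\<^sub>R v\<close>
    and \<open>h *\<^sub>R w\<close> lies in the ball of radius \<open>d\<close>. The
    \<open>+ 1\<close> covers \<open>v = w = 0\<close> and makes the estimate strict.\<close>
  define h where "h = d / (norm v + norm w + 1)"
  have pos: "norm v + norm w + 1 > 0" by (simp add: add_nonneg_pos)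
  then have h: "h > 0" using d by (simp add: h_def)
  have close: "dist (x + t *\<^sub>R w + s *\<^sub>R v) x < d" if "0 \<le> s" "s \<le> h" "0 \<le> t" "t \<le> h" for s t
  proof -
    have "dist (x + t *\<^sub>R w + s *\<^sub>R v) x = norm (t *\<^sub>R w + s *\<^sub>R v)"
      by (simp add: dist_norm add.assoc)
    also have "\<dots> \<le> t * norm w + s * norm v"
      using that norm_triangle_ineq[of "t *\<^sub>R w" "s *\<^sub>R v"] by simp
    also have "\<dots> \<le> h * norm w + h * norm v"
      using that by (intro add_mono mult_right_mono) auto
    also have "\<dots> < h * (norm v + norm w + 1)" using h by (simp add: algebra_simps)
    also have "\<dots> = d" using pos by (simp add: h_def)
    finally show ?thesis .
  qed
  have close': "dist (x + t *\<^sub>R v + s *\<^sub>R w) x < d" if "0 \<le> s" "s \<le> h" "0 \<le> t" "t \<le> h" for s t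
    using close[of t s] that by (simp add: add_ac)
  obtain s t where st: "0 \<le> s" "s \<le> h" "0 \<le> t" "t \<le> h"
    "f (x + h *\<^sub>R w + h *\<^sub>R v) - f (x + h *\<^sub>R v) - (f (x + h *\<^sub>R w) - f x)
      = h * (h * A' (x + t *\<^sub>R w + s *\<^sub>R v) w)"
    by (rule mixed_second_difference[OF h, of f f' x w v A']) (use f A'(1) near close in blast)+
  obtain s' t' where st': "0 \<le> s'" "s' \<le> h" "0 \<le> t'" "t' \<le> h"
    "f (x + h *\<^sub>R v + h *\<^sub>R w) - f (x + h *\<^sub>R w) - (f (x + h *\<^sub>R v) - f x)
      = h * (h * B' (x + t' *\<^sub>R v + s' *\<^sub>R w) v)"
    by (rule mixed_second_difference[OF h, of f f' x v w B']) (use f B'(1) near close' in blast)+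
  have "h * (h * A' (x + t *\<^sub>R w + s *\<^sub>R v) w) = h * (h * B' (x + t' *\<^sub>R v + s' *\<^sub>R w) v)"
    unfolding st(5)[symmetric] st'(5)[symmetric] by (simp add: add_ac)
  then have "A' (x + t *\<^sub>R w + s *\<^sub>R v) w = B' (x + t' *\<^sub>R v + s' *\<^sub>R w) v"
    using h by simp
  moreover have "dist (A' (x + t *\<^sub>R w + s *\<^sub>R v) w) (A' x w) < \<epsilon>"
    using near[OF close] st by blast
  moreover have "dist (B' (x + t' *\<^sub>R v + s' *\<^sub>R w) v) (B' x v) < \<epsilon>"
    using near[OF close'] st' by blast
  ultimately show False
    using dist_triangle_half_r[of _ "A w" "dist (A w) (B v)" "B v"] by (simp add: AB \<epsilon>_def)
qed

section \<open>Relatively open subsets of affine subspaces\<close>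

text \<open>Bundles an ambient extension near \<open>x\<close> with its derivative at all points of
  \<open>U\<close>, so that one extension also serves at the neighbours of \<open>x\<close>; this is
  what allows differentiating \<open>mdiff\<close> once more.\<close>

definition local_extension ::
    "'a::euclidean_space set \<Rightarrow> ('a \<Rightarrow> 'b::euclidean_space) \<Rightarrow> 'a \<Rightarrow> 'a set \<Rightarrow> ('a \<Rightarrow> 'b) \<Rightarrow> ('a \<Rightarrow> 'a \<Rightarrow> 'b) \<Rightarrow> bool"
  where "local_extension M f x U F F' \<longleftrightarrow> open U \<and> x \<in> U \<and> smooth_on U F \<and>
    (\<forall>y\<in>U. (F has_derivative F' y) (at y)) \<and> (\<forall>v. smooth_on U (\<lambda>y. F' y v)) \<and> (\<forall>y\<in>M \<inter> U. F y = f y)"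

lemma smooth_map_on_local_extension:
  assumes "smooth_map_on M f" "x \<in> M"
  obtains U F F' where "local_extension M f x U F F'"
proof -
  obtain U F where U: "open U" "x \<in> U" "smooth_on U F" "\<forall>y\<in>M \<inter> U. F y = f y"
    using assms by (auto simp: smooth_map_on_def)
  obtain F' where "\<And>x. x \<in> U \<Longrightarrow> (F has_derivative F' x) (at x)" "\<And>v. smooth_on U (\<lambda>x. F' x v)"
    using smooth_on_open_derivative[OF U(1,3)] by blast
  with U have "local_extension M f x U F F'" by (simp add: local_extension_def)
  then show ?thesis by (rule that)
qed

lemma smooth_map_on_const: "smooth_map_on M (\<lambda>_. c)"
  unfolding smooth_map_on_def by (auto intro!: exI[of _ UNIV] exI[of _ "\<lambda>_. c"] smooth_on_const)

lemma smooth_map_on_cong: "smooth_map_on M f \<Longrightarrow> (\<And>x. x \<in> M \<Longrightarrow> f x = g x) \<Longrightarrow> smooth_map_on M g"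
  unfolding smooth_map_on_def by (metis IntD1)

lemma smooth_map_on_linear:
  assumes "bounded_linear L" "smooth_map_on M f"
  shows "smooth_map_on M (\<lambda>x. L (f x))"
  unfolding smooth_map_on_def
proof
  fix x assume "x \<in> M"
  then obtain U F where "open U" "x \<in> U" "smooth_on U F" "\<forall>y\<in>M \<inter> U. F y = f y"
    using assms by (auto simp: smooth_map_on_def)
  then show "\<exists>U F. open U \<and> x \<in> U \<and> smooth_on U F \<and> (\<forall>y\<in>M \<inter> U. F y = L (f y))"
    using smooth_on_linear[OF assms(1)] by (auto intro!: exI[of _ U] exI[of _ "\<lambda>x. L (F x)"])
qed

lemma smooth_map_on_binary:
  fixes M :: "'a::euclidean_space set"
  assumes "smooth_map_on M f" "smooth_map_on M g"
    and p: "\<And>U F G. smooth_on (U :: 'a set) F \<Longrightarrow> smooth_on U G \<Longrightarrow> smooth_on U (\<lambda>x. p (F x) (G x))"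
  shows "smooth_map_on M (\<lambda>x. p (f x) (g x))"
  unfolding smooth_map_on_def
proof
  fix x assume "x \<in> M"
  obtain U F where U: "open U" "x \<in> U" "smooth_on U F" "\<forall>y\<in>M \<inter> U. F y = f y"
    using assms(1) \<open>x \<in> M\<close> by (auto simp: smooth_map_on_def)
  obtain V G where V: "open V" "x \<in> V" "smooth_on V G" "\<forall>y\<in>M \<inter> V. G y = g y"
    using assms(2) \<open>x \<in> M\<close> by (auto simp: smooth_map_on_def)
  have "smooth_on (U \<inter> V) (\<lambda>x. p (F x) (G x))"
    using U V by (intro p) (auto intro: smooth_on_subset)
  with U V show "\<exists>U F. open U \<and> x \<in> U \<and> smooth_on U F \<and> (\<forall>y\<in>M \<inter> U. F y = p (f y) (g y))"
    by (intro exI[of _ "U \<inter> V"] exI[of _ "\<lambda>x. p (F x) (G x)"]) auto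
qed

lemmas smooth_map_on_add = smooth_map_on_binary[OF _ _ smooth_on_add]

lemma smooth_map_on_bilinear:
  "bounded_bilinear p \<Longrightarrow> smooth_map_on M f \<Longrightarrow> smooth_map_on M g \<Longrightarrow> smooth_map_on M (\<lambda>x. p (f x) (g x))"
  by (rule smooth_map_on_binary[OF _ _ smooth_on_bilinear])

lemma smooth_map_on_sum:
  "(\<And>i. i \<in> I \<Longrightarrow> smooth_map_on M (f i)) \<Longrightarrow> smooth_map_on M (\<lambda>x. \<Sum>i\<in>I. f i x)"
  by (induction I rule: infinite_finite_induct) (auto intro: smooth_map_on_const smooth_map_on_add)

text \<open>Differentiating along straight lines suffices because the manifolds below are relatively
  open in an affine subspace.\<close>

definition line_deriv :: "('a::real_normed_vector \<Rightarrow> 'b::real_normed_vector) \<Rightarrow> 'a \<Rightarrow> 'a \<Rightarrow> 'b" where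
  "line_deriv f x v = vector_derivative (\<lambda>t. f (x + t *\<^sub>R v)) (at 0)"

lemma line_derivI:
  "((\<lambda>t. f (x + t *\<^sub>R v)) has_vector_derivative d) (at 0) \<Longrightarrow> line_deriv f x v = d"
  by (simp add: line_deriv_def vector_derivative_at)

lemma has_vector_derivative_transform_eventually:
  assumes "(f has_vector_derivative d) (at x)" "\<forall>\<^sub>F t in nhds x. f t = g t"
  shows "(g has_vector_derivative d) (at x)"
proof -
  obtain S where S: "open S" "x \<in> S" "\<And>t. t \<in> S \<Longrightarrow> f t = g t"
    using assms(2) by (auto simp: eventually_nhds)
  from has_vector_derivative_transform_within_open[OF assms(1) S(1,2)] S(3) show ?thesis by blast
qed

text \<open>The orthogonal projection \<open>L\<close> onto \<open>T\<close> fixes the curve near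
  \<open>x\<close>, hence it also fixes the derivative.\<close>

lemma has_vector_derivative_in_subspace:
  fixes \<gamma> :: "real \<Rightarrow> 'a::euclidean_space"
  assumes T: "subspace T" and d: "(\<gamma> has_vector_derivative d) (at x)"
    and \<gamma>: "\<forall>\<^sub>F t in nhds x. \<gamma> t \<in> T"
  shows "d \<in> T"
proof -
  obtain B where B: "B \<subseteq> T" "pairwise orthogonal B" "\<And>b. b \<in> B \<Longrightarrow> norm b = 1" "finite B" "span B = T"
    using orthonormal_basis_subspace[OF T] by (metis independent_imp_finite)
  define L where "L = (\<lambda>v. \<Sum>b\<in>B. (v \<bullet> b) *\<^sub>R b)"
  have L: "bounded_linear L"
    unfolding L_def by (intro bounded_linear_intros)
  have "L v = v" if "v \<in> T" for v
    unfolding L_def using orthonormal_basis_expand[OF B(2,3) _ B(4)] that B(5)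
    by simp
  with \<gamma> have "\<forall>\<^sub>F t in nhds x. L (\<gamma> t) = \<gamma> t"
    by (auto elim: eventually_mono)
  with bounded_linear.has_vector_derivative[OF L d]
  have "(\<gamma> has_vector_derivative L d) (at x)"
    by (rule has_vector_derivative_transform_eventually)
  then have "d = L d" using d by (rule vector_derivative_unique_at[rotated])
  moreover have "L d \<in> T"
    unfolding L_def using B by (intro subspace_sum T subspace_scale) auto
  ultimately show ?thesis by simp
qed

text \<open>Models a relatively open subset of an affine subspace with direction \<open>T\<close>.
  Openness enters through short segments, which realise every vector of \<open>T\<close> by a
  straight curve and keep derivatives along lines inside \<open>M\<close>.\<close>

locale flat_submanifold =
  fixes M T :: "'a::euclidean_space set"
  assumes subspace_T: "subspace T"
    and diff_in_T: "x \<in> M \<Longrightarrow> y \<in> M \<Longrightarrow> y - x \<in> T"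
    and segment: "x \<in> M \<Longrightarrow> v \<in> T \<Longrightarrow> \<exists>e>0. \<forall>t. \<bar>t\<bar> < e \<longrightarrow> x + t *\<^sub>R v \<in> M"
begin

lemma curve_through_line:
  assumes "x \<in> M" "v \<in> T"
  shows "curve_through M x v (\<lambda>t. x + t *\<^sub>R v)"
proof -
  obtain e where "e > 0" "\<forall>t. \<bar>t\<bar> < e \<longrightarrow> x + t *\<^sub>R v \<in> M"
    using segment assms by blast
  moreover have "smooth_on S (\<lambda>t. x + t *\<^sub>R v)" for S
    by (intro smooth_on_add smooth_on_const smooth_on_linear[OF bounded_linear_scaleR_left] smooth_on_ident)
  moreover have "((\<lambda>t. x + t *\<^sub>R v) has_vector_derivative v) (at 0)"
    by (auto intro!: derivative_eq_intros)
  ultimately show ?thesis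
    by (auto simp: curve_through_def intro!: exI[of _ e])
qed

lemma tangent_space_eq:
  assumes "x \<in> M"
  shows "tangent_space M x = T"
proof
  show "T \<subseteq> tangent_space M x"
    using curve_through_line[OF assms] by (auto simp: tangent_space_def)
  show "tangent_space M x \<subseteq> T"
  proof
    fix v assume "v \<in> tangent_space M x"
    then obtain \<gamma> e where \<gamma>: "(\<gamma> has_vector_derivative v) (at 0)" "e > 0" "\<gamma> ` {-e<..<e} \<subseteq> M"
      by (auto simp: tangent_space_def curve_through_def)
    have "((\<lambda>t. \<gamma> t - x) has_vector_derivative v) (at 0)"
      using has_vector_derivative_diff[OF \<gamma>(1) has_vector_derivative_const, of x] by simp
    moreover have "\<forall>\<^sub>F t in nhds 0. t \<in> {-e<..<e}"
      using \<gamma> by (intro eventually_nhds_in_open) auto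
    then have "\<forall>\<^sub>F t in nhds 0. \<gamma> t - x \<in> T"
      by eventually_elim (rule diff_in_T[OF assms], use \<gamma>(3) in blast)
    ultimately show "v \<in> T"
      by (rule has_vector_derivative_in_subspace[OF subspace_T])
  qed
qed

lemma eventually_line_in_M:
  assumes "x \<in> M" "v \<in> T"
  shows "\<forall>\<^sub>F t in nhds 0. x + t *\<^sub>R v \<in> M"
  using segment[OF assms] by (simp add: eventually_nhds_metric)

text \<open>Agreement on \<open>M\<close> is enough because the line stays in \<open>M\<close> for
  small \<open>t\<close>. This transfers derivatives from an extension to a function given on
  \<open>M\<close>.\<close>

lemma has_vector_derivative_line_cong:
  assumes "x \<in> M" "v \<in> T" "\<forall>\<^sub>F y in nhds x. y \<in> M \<longrightarrow> F y = f y"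
    and "((\<lambda>t. F (x + t *\<^sub>R v)) has_vector_derivative d) (at 0)"
  shows "((\<lambda>t. f (x + t *\<^sub>R v)) has_vector_derivative d) (at 0)"
proof -
  have "((\<lambda>t. x + t *\<^sub>R v) \<longlongrightarrow> x + 0 *\<^sub>R v) (nhds 0)"
    by (intro tendsto_intros filterlim_ident)
  then have "\<forall>\<^sub>F t in nhds 0. x + t *\<^sub>R v \<in> M \<longrightarrow> F (x + t *\<^sub>R v) = f (x + t *\<^sub>R v)"
    using eventually_compose_filterlim[OF assms(3)] by simp
  with eventually_line_in_M[OF assms(1,2)]
  have "\<forall>\<^sub>F t in nhds 0. F (x + t *\<^sub>R v) = f (x + t *\<^sub>R v)"
    by eventually_elim simp
  with assms(4) show ?thesis
    by (rule has_vector_derivative_transform_eventually)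
qed

lemma eventually_extension:
  "local_extension M f x U F F' \<Longrightarrow> y \<in> U \<Longrightarrow> \<forall>\<^sub>F z in nhds y. z \<in> M \<longrightarrow> F z = f z"
  by (auto simp: local_extension_def eventually_nhds)

lemma has_vector_derivative_extension:
  assumes "local_extension M f x U F F'" "y \<in> M" "y \<in> U" "v \<in> T"
  shows "((\<lambda>t. f (y + t *\<^sub>R v)) has_vector_derivative F' y v) (at 0)"
proof (rule has_vector_derivative_line_cong[OF assms(2,4) eventually_extension[OF assms(1,3)]])
  show "((\<lambda>t. F (y + t *\<^sub>R v)) has_vector_derivative F' y v) (at 0)"
    using assms by (intro has_vector_derivative_line) (simp add: local_extension_def)
qed

lemma line_deriv_extension:
  assumes "local_extension M f x U F F'" "y \<in> M" "y \<in> U" "v \<in> T"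
  shows "line_deriv f y v = F' y v"
  by (rule line_derivI[OF has_vector_derivative_extension[OF assms]])

text \<open>Existence is the chain rule for the extension along any curve; uniqueness holds because
  the straight line is one of the curves.\<close>

lemma mdiff_extension:
  assumes ext: "local_extension M f x U F F'" and y: "y \<in> M" "y \<in> U" and v: "v \<in> T"
  shows "mdiff M f y v = F' y v"
  unfolding mdiff_def
proof (rule the_equality)
  have F: "(F has_derivative F' y) (at y)" using ext y by (simp add: local_extension_def)
  show "\<forall>\<gamma>. curve_through M y v \<gamma> \<longrightarrow> (f \<circ> \<gamma> has_real_derivative F' y v) (at 0)"
  proof (intro allI impI)
    fix \<gamma> assume "curve_through M y v \<gamma>"
    then obtain e where e: "e > 0" "\<gamma> ` {-e<..<e} \<subseteq> M" and \<gamma>: "\<gamma> 0 = y" "(\<gamma> has_vector_derivative v) (at 0)"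
      by (auto simp: curve_through_def)
    interpret F': bounded_linear "F' y" using F by (rule has_derivative_bounded_linear)
    have "(\<gamma> has_derivative (\<lambda>t. t *\<^sub>R v)) (at 0)"
      using \<gamma>(2) by (simp add: has_vector_derivative_def)
    from has_derivative_compose[OF this, of F "F' y"] F
    have "((\<lambda>t. F (\<gamma> t)) has_vector_derivative F' y v) (at 0)"
      by (simp add: \<gamma>(1) has_vector_derivative_def F'.scaleR)
    moreover have "\<forall>\<^sub>F t in nhds 0. F (\<gamma> t) = f (\<gamma> t)"
    proof -
      have "isCont \<gamma> 0" using \<gamma>(2) by (rule has_vector_derivative_continuous)
      then have "(\<gamma> \<longlongrightarrow> y) (nhds 0)"
        using \<gamma>(1) by (simp add: isCont_def tendsto_nhds_iff)
      then have "\<forall>\<^sub>F t in nhds 0. \<gamma> t \<in> U"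
        using ext y by (intro topological_tendstoD) (auto simp: local_extension_def)
      moreover have "\<forall>\<^sub>F t in nhds 0. t \<in> {-e<..<e}"
        using e by (intro eventually_nhds_in_open) auto
      ultimately show ?thesis
      proof eventually_elim
        case (elim t)
        then have "\<gamma> t \<in> M \<inter> U" using e(2) by blast
        then show ?case using ext by (simp add: local_extension_def)
      qed
    qed
    ultimately have "((\<lambda>t. f (\<gamma> t)) has_vector_derivative F' y v) (at 0)"
      by (rule has_vector_derivative_transform_eventually)
    then show "(f \<circ> \<gamma> has_real_derivative F' y v) (at 0)"
      by (simp add: has_real_derivative_iff_has_vector_derivative o_def)
  qed
next
  fix d assume "\<forall>\<gamma>. curve_through M y v \<gamma> \<longrightarrow> (f \<circ> \<gamma> has_real_derivative d) (at 0)"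
  then have "((\<lambda>t. f (y + t *\<^sub>R v)) has_vector_derivative d) (at 0)"
    using curve_through_line[OF y(1) v] by (auto simp: has_real_derivative_iff_has_vector_derivative o_def)
  from line_derivI[OF this] line_deriv_extension[OF ext y v] show "d = F' y v" by simp
qed

lemma mdiff_eq_line_deriv:
  assumes "smooth_map_on M f" "x \<in> M" "v \<in> T"
  shows "mdiff M f x v = line_deriv f x v"
proof -
  obtain U F F' where ext: "local_extension M f x U F F'"
    using smooth_map_on_local_extension assms by blast
  then have "x \<in> U" by (simp add: local_extension_def)
  with mdiff_extension[OF ext] line_deriv_extension[OF ext] assms show ?thesis by simp
qed

lemma smooth_map_has_line_deriv:
  assumes "smooth_map_on M f" "x \<in> M" "v \<in> T"
  shows "((\<lambda>t. f (x + t *\<^sub>R v)) has_vector_derivative line_deriv f x v) (at 0)"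
proof -
  obtain U F F' where ext: "local_extension M f x U F F'"
    using smooth_map_on_local_extension assms by blast
  then have "x \<in> U" by (simp add: local_extension_def)
  from has_vector_derivative_extension[OF ext assms(2) this assms(3)] show ?thesis
    by (simp add: line_derivI)
qed

section \<open>Vector fields and their directional derivatives\<close>

lemma vector_fields_eq:
  "vector_fields M = {X. smooth_map_on M X \<and> (\<forall>x\<in>M. X x \<in> T) \<and> (\<forall>x. x \<notin> M \<longrightarrow> X x = 0)}"
  by (auto simp: vector_fields_def tangent_space_eq)

lemma const_vector_field: "v \<in> T \<Longrightarrow> (\<lambda>x. if x \<in> M then v else 0) \<in> vector_fields M"
  by (auto simp: vector_fields_eq intro: smooth_map_on_cong[OF smooth_map_on_const[of M v]])

lemma vector_fields_combine:
  assumes "X \<in> vector_fields M" "Y \<in> vector_fields M" "smooth_map_on M f" "smooth_map_on M h"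
  shows "(\<lambda>x. f x *\<^sub>R X x + h x *\<^sub>R Y x) \<in> vector_fields M"
  using assms subspace_T
  by (auto simp: vector_fields_eq subspace_add subspace_scale
      intro!: smooth_map_on_add smooth_map_on_bilinear[OF bounded_bilinear_scaleR])

lemma local_extension_derivative:
  assumes "local_extension M f x U F F'"
  shows "(F has_derivative F' x) (at x)" "bounded_linear (F' x)"
  using assms by (auto simp: local_extension_def intro: has_derivative_bounded_linear)

lemma apply_derivative_expand:
  assumes "bounded_linear L"
  shows "L v = (\<Sum>b\<in>Basis. (v \<bullet> b) *\<^sub>R L b)"
proof -
  interpret L: bounded_linear L by fact
  have "L v = L (\<Sum>b\<in>Basis. (v \<bullet> b) *\<^sub>R b)" by (simp only: euclidean_representation)
  then show ?thesis by (simp add: L.sum L.scaleR)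
qed

text \<open>Smoothness of \<open>F'\<close> is known for fixed directions only. Expanding the moving
  direction \<open>G y\<close> in the basis reduces to these.\<close>

lemma smooth_on_apply_derivative:
  assumes "smooth_on U G" "\<And>v. smooth_on U (\<lambda>y. F' y v)" "\<And>y. y \<in> U \<Longrightarrow> bounded_linear (F' y)"
  shows "smooth_on U (\<lambda>y. F' y (G y))"
proof (rule smooth_on_cong)
  show "smooth_on U (\<lambda>y. \<Sum>b\<in>Basis. (G y \<bullet> b) *\<^sub>R F' y b)"
    by (intro smooth_on_sum smooth_on_bilinear[OF bounded_bilinear_scaleR] assms
        smooth_on_linear[OF bounded_linear_inner_left])
  show "(\<Sum>b\<in>Basis. (G y \<bullet> b) *\<^sub>R F' y b) = F' y (G y)" if "y \<in> U" for y
    by (rule apply_derivative_expand[OF assms(3)[OF that], symmetric])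
qed

lemma smooth_map_on_line_deriv:
  assumes f: "smooth_map_on M f" and X: "smooth_map_on M X" "\<And>x. x \<in> M \<Longrightarrow> X x \<in> T"
  shows "smooth_map_on M (\<lambda>x. line_deriv f x (X x))"
  unfolding smooth_map_on_def
proof
  fix x assume x: "x \<in> M"
  obtain U F F' where F: "local_extension M f x U F F'"
    using smooth_map_on_local_extension[OF f x] .
  obtain V G where V: "open V" "x \<in> V" "smooth_on V G" "\<forall>y\<in>M \<inter> V. G y = X y"
    using X x by (auto simp: smooth_map_on_def)
  have "smooth_on (U \<inter> V) (\<lambda>y. F' y (G y))"
  proof (rule smooth_on_apply_derivative[where G = G and F' = F'])
    show "smooth_on (U \<inter> V) G" using V(3) by (rule smooth_on_subset) simp
    show "smooth_on (U \<inter> V) (\<lambda>y. F' y v)" for v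
    proof -
      have "smooth_on U (\<lambda>y. F' y v)" using F unfolding local_extension_def by blast
      then show ?thesis by (rule smooth_on_subset) simp
    qed
    show "bounded_linear (F' y)" if "y \<in> U \<inter> V" for y
      using F that by (intro has_derivative_bounded_linear[of F _ "at y"]) (simp add: local_extension_def)
  qed
  moreover have "F' y (G y) = line_deriv f y (X y)" if "y \<in> M \<inter> (U \<inter> V)" for y
    using line_deriv_extension[OF F, of y "X y"] that V X(2) by simp
  ultimately show "\<exists>U F. open U \<and> x \<in> U \<and> smooth_on U F \<and> (\<forall>y\<in>M \<inter> U. F y = line_deriv f y (X y))"
    using F V by (intro exI[of _ "U \<inter> V"] exI[of _ "\<lambda>y. F' y (G y)"]) (auto simp: local_extension_def)
qed

text \<open>All tangent spaces coincide, so along the line the field takes values in the fixed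
  subspace \<open>T\<close> and its derivative needs no tangential projection.\<close>

lemma line_deriv_in_T:
  assumes "X \<in> vector_fields M" "x \<in> M" "v \<in> T"
  shows "line_deriv X x v \<in> T"
proof (rule has_vector_derivative_in_subspace[OF subspace_T])
  show "((\<lambda>t. X (x + t *\<^sub>R v)) has_vector_derivative line_deriv X x v) (at 0)"
    using assms by (intro smooth_map_has_line_deriv) (auto simp: vector_fields_eq)
  show "\<forall>\<^sub>F t in nhds 0. X (x + t *\<^sub>R v) \<in> T"
    using eventually_line_in_M[OF assms(2,3)]
    by eventually_elim (use assms in \<open>simp add: vector_fields_eq\<close>)
qed

lemma line_deriv_linear:
  assumes "smooth_map_on M f" "x \<in> M" "v \<in> T" "w \<in> T"
  shows "line_deriv f x (a *\<^sub>R v + b *\<^sub>R w) = a *\<^sub>R line_deriv f x v + b *\<^sub>R line_deriv f x w"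
proof -
  obtain U F F' where F: "local_extension M f x U F F'"
    using smooth_map_on_local_extension assms by blast
  then have x: "x \<in> U" by (simp add: local_extension_def)
  interpret F': bounded_linear "F' x" by (rule local_extension_derivative[OF F])
  have "a *\<^sub>R v + b *\<^sub>R w \<in> T" using assms subspace_T by (simp add: subspace_add subspace_scale)
  then show ?thesis
    using line_deriv_extension[OF F assms(2) x] assms by (simp add: F'.add F'.scaleR)
qed

text \<open>The zero values follow the conventions: fields vanish off \<open>M\<close>, and a
  connection vanishes on arguments that are not fields.\<close>

definition flat_connection :: "('a \<Rightarrow> 'a) \<Rightarrow> ('a \<Rightarrow> 'a) \<Rightarrow> 'a \<Rightarrow> 'a" where
  "flat_connection X Y = (if X \<in> vector_fields M \<and> Y \<in> vector_fields M
     then \<lambda>x. if x \<in> M then line_deriv Y x (X x) else 0 else (\<lambda>_. 0))"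

lemma flat_connection_apply:
  "X \<in> vector_fields M \<Longrightarrow> Y \<in> vector_fields M \<Longrightarrow> x \<in> M \<Longrightarrow> flat_connection X Y x = line_deriv Y x (X x)"
  by (simp add: flat_connection_def)

lemma flat_connection_outside: "x \<notin> M \<Longrightarrow> flat_connection X Y x = 0"
  by (simp add: flat_connection_def)

lemma flat_connection_field:
  assumes "X \<in> vector_fields M" "Y \<in> vector_fields M"
  shows "flat_connection X Y \<in> vector_fields M"
  unfolding vector_fields_eq
proof (intro CollectI conjI ballI allI impI)
  show "smooth_map_on M (flat_connection X Y)"
  proof (rule smooth_map_on_cong)
    show "smooth_map_on M (\<lambda>x. line_deriv Y x (X x))"
      using assms by (intro smooth_map_on_line_deriv) (simp_all add: vector_fields_eq)
  qed (simp add: flat_connection_apply[OF assms])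
  show "flat_connection X Y x \<in> T" if "x \<in> M" for x
  proof -
    have "X x \<in> T" using assms(1) that by (simp add: vector_fields_eq)
    then show ?thesis
      by (simp add: flat_connection_apply[OF assms that] line_deriv_in_T[OF assms(2) that])
  qed
qed (simp add: flat_connection_outside)

lemma affine_connection_flat: "affine_connection M flat_connection"
  unfolding affine_connection_def
proof (intro conjI ballI allI impI)
  fix X X' Y and f h :: "'a \<Rightarrow> real"
  assume X: "X \<in> vector_fields M" "X' \<in> vector_fields M" and Y: "Y \<in> vector_fields M"
    and "smooth_map_on M f \<and> smooth_map_on M h"
  then have Z: "(\<lambda>x. f x *\<^sub>R X x + h x *\<^sub>R X' x) \<in> vector_fields M"
    by (intro vector_fields_combine) auto
  show "flat_connection (\<lambda>x. f x *\<^sub>R X x + h x *\<^sub>R X' x) Y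
      = (\<lambda>x. f x *\<^sub>R flat_connection X Y x + h x *\<^sub>R flat_connection X' Y x)"
  proof
    fix x
    show "flat_connection (\<lambda>x. f x *\<^sub>R X x + h x *\<^sub>R X' x) Y x
      = f x *\<^sub>R flat_connection X Y x + h x *\<^sub>R flat_connection X' Y x"
    proof (cases "x \<in> M")
      case True
      with X Y show ?thesis
        by (simp add: flat_connection_apply[OF Z Y True] flat_connection_apply)
          (intro line_deriv_linear, auto simp: vector_fields_eq)
    qed (simp add: flat_connection_outside)
  qed
next
  fix X Y Y' and a b :: real
  assume X: "X \<in> vector_fields M" and Y: "Y \<in> vector_fields M" "Y' \<in> vector_fields M"
  then have Z: "(\<lambda>x. a *\<^sub>R Y x + b *\<^sub>R Y' x) \<in> vector_fields M"
    by (intro vector_fields_combine smooth_map_on_const)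
  show "flat_connection X (\<lambda>x. a *\<^sub>R Y x + b *\<^sub>R Y' x)
      = (\<lambda>x. a *\<^sub>R flat_connection X Y x + b *\<^sub>R flat_connection X Y' x)"
  proof
    fix x
    show "flat_connection X (\<lambda>x. a *\<^sub>R Y x + b *\<^sub>R Y' x) x
      = a *\<^sub>R flat_connection X Y x + b *\<^sub>R flat_connection X Y' x"
    proof (cases "x \<in> M")
      case True
      have "((\<lambda>t. a *\<^sub>R Y (x + t *\<^sub>R X x) + b *\<^sub>R Y' (x + t *\<^sub>R X x)) has_vector_derivative
          a *\<^sub>R line_deriv Y x (X x) + b *\<^sub>R line_deriv Y' x (X x)) (at 0)"
        using X Y True
        by (intro has_vector_derivative_add bounded_linear.has_vector_derivative[OF bounded_linear_scaleR_right]
            smooth_map_has_line_deriv) (auto simp: vector_fields_eq)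
      from line_derivI[OF this] X Y True show ?thesis
        by (simp add: flat_connection_apply[OF X Z True] flat_connection_apply)
    qed (simp add: flat_connection_outside)
  qed
next
  fix X Y and f :: "'a \<Rightarrow> real"
  assume X: "X \<in> vector_fields M" and Y: "Y \<in> vector_fields M" and f: "smooth_map_on M f"
  then have Z: "(\<lambda>x. f x *\<^sub>R Y x) \<in> vector_fields M"
    using vector_fields_combine[OF Y Y f smooth_map_on_const, of 0] by simp
  show "flat_connection X (\<lambda>x. f x *\<^sub>R Y x)
      = (\<lambda>x. f x *\<^sub>R flat_connection X Y x + mdiff M f x (X x) *\<^sub>R Y x)"
  proof
    fix x
    show "flat_connection X (\<lambda>x. f x *\<^sub>R Y x) x
      = f x *\<^sub>R flat_connection X Y x + mdiff M f x (X x) *\<^sub>R Y x"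
    proof (cases "x \<in> M")
      case True
      have XT: "X x \<in> T" using X True by (simp add: vector_fields_eq)
      have "((\<lambda>t. f (x + t *\<^sub>R X x) *\<^sub>R Y (x + t *\<^sub>R X x)) has_vector_derivative
          f (x + 0 *\<^sub>R X x) *\<^sub>R line_deriv Y x (X x) + line_deriv f x (X x) *\<^sub>R Y (x + 0 *\<^sub>R X x)) (at 0)"
        using Y True XT f smooth_map_has_line_deriv[OF f True XT]
        by (intro has_vector_derivative_scaleR smooth_map_has_line_deriv)
          (auto simp: vector_fields_eq has_real_derivative_iff_has_vector_derivative)
      from line_derivI[OF this] X Y True show ?thesis
        by (simp add: flat_connection_apply[OF X Z True] flat_connection_apply mdiff_eq_line_deriv[OF f True XT])
    qed (use Y in \<open>simp add: flat_connection_outside vector_fields_eq\<close>)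
  qed
next
  fix X Y assume "X \<notin> vector_fields M \<or> Y \<notin> vector_fields M"
  then show "flat_connection X Y = (\<lambda>_. 0)" by (auto simp: flat_connection_def)
qed (rule flat_connection_field)

text \<open>The summand \<open>D v\<close> is the second derivative of \<open>f\<close> in the directions \<open>v\<close> and \<open>Y x\<close>; it is
  symmetric and cancels in the commutator of two vector fields.\<close>

lemma iterated_mdiff:
  assumes f: "local_extension M f x U F F'" and Y: "Y \<in> vector_fields M" and x: "x \<in> M" "v \<in> T"
    and D: "((\<lambda>y. F' y (Y x)) has_derivative D) (at x)"
  shows "mdiff M (\<lambda>y. mdiff M f y (Y y)) x v = F' x (line_deriv Y x v) + D v"
proof -
  have xU: "x \<in> U" "open U" using f by (auto simp: local_extension_def)
  have blF: "bounded_linear (F' y)" if "y \<in> U" for y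
    using f that by (auto simp: local_extension_def intro: has_derivative_bounded_linear)
  have Ysm: "smooth_map_on M Y" and YT: "\<And>y. y \<in> M \<Longrightarrow> Y y \<in> T" using Y by (auto simp: vector_fields_eq)
  obtain V H H' where H: "local_extension M Y x V H H'"
    using smooth_map_on_local_extension[OF Ysm x(1)] .
  then have xV: "x \<in> V" "open V" and Hx: "H x = Y x" using x by (auto simp: local_extension_def)
  \<comment> \<open>An ambient extension of the inner function, with \<open>F'\<close> extending the
    differential of \<open>f\<close> and \<open>H\<close> extending \<open>Y\<close>. The product
    rule splits its derivative into the part where \<open>F'\<close> varies and the part where
    \<open>H\<close> varies.\<close>
  define K where "K = (\<lambda>y. F' y (H y))"
  have "smooth_on (U \<inter> V) K"
    unfolding K_def
  proof (rule smooth_on_apply_derivative[where G = H and F' = F'])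
    have "smooth_on V H" using H unfolding local_extension_def by blast
    then show "smooth_on (U \<inter> V) H" by (rule smooth_on_subset) simp
    show "smooth_on (U \<inter> V) (\<lambda>y. F' y v)" for v
    proof -
      have "smooth_on U (\<lambda>y. F' y v)" using f unfolding local_extension_def by blast
      then show ?thesis by (rule smooth_on_subset) simp
    qed
  qed (use blF in simp)
  then obtain K' where K': "\<And>y. y \<in> U \<inter> V \<Longrightarrow> (K has_derivative K' y) (at y)"
      "\<And>v. smooth_on (U \<inter> V) (\<lambda>y. K' y v)" and K: "smooth_on (U \<inter> V) K"
    using smooth_on_open_derivative[of "U \<inter> V" K] xU xV by blast
  have ext: "local_extension M (\<lambda>y. mdiff M f y (Y y)) x (U \<inter> V) K K'"
    unfolding local_extension_def
  proof (intro conjI ballI allI)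
    show "K y = mdiff M f y (Y y)" if "y \<in> M \<inter> (U \<inter> V)" for y
      using mdiff_extension[OF f, of y "Y y"] that YT[of y] H by (simp add: K_def local_extension_def)
  qed (use K K' xU xV in auto)
  have dF: "((\<lambda>y. F' y b) has_derivative frechet_derivative (\<lambda>y. F' y b) (at x)) (at x)" for b
  proof -
    have "smooth_on U (\<lambda>y. F' y b)" using f by (simp add: local_extension_def)
    from smooth_on_open_derivative[OF xU(2) this] xU(1) show ?thesis
      by (metis frechet_derivative_at)
  qed
  define E where "E = (\<lambda>b. frechet_derivative (\<lambda>y. F' y b) (at x))"
  have dH: "(H has_derivative H' x) (at x)" using H xV by (simp add: local_extension_def)
  \<comment> \<open>In \<open>D\<close> the vector \<open>Y x\<close> is frozen, in \<open>K\<close>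
    the vector \<open>H y\<close> moves. Writing both derivatives through the basis derivatives
    \<open>E b\<close> makes them comparable.\<close>
  have "D = (\<lambda>v. \<Sum>b\<in>Basis. (Y x \<bullet> b) *\<^sub>R E b v)"
  proof (rule has_derivative_unique[OF D])
    have "((\<lambda>y. \<Sum>b\<in>Basis. (Y x \<bullet> b) *\<^sub>R F' y b) has_derivative (\<lambda>v. \<Sum>b\<in>Basis. (Y x \<bullet> b) *\<^sub>R E b v)) (at x)"
      unfolding E_def by (intro has_derivative_sum has_derivative_scaleR_right dF)
    then show "((\<lambda>y. F' y (Y x)) has_derivative (\<lambda>v. \<Sum>b\<in>Basis. (Y x \<bullet> b) *\<^sub>R E b v)) (at x)"
      by (rule has_derivative_transform_within_open[OF _ xU(2,1)])
        (rule apply_derivative_expand[OF blF, symmetric])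
  qed
  moreover have "K' x = (\<lambda>v. \<Sum>b\<in>Basis. (H x \<bullet> b) *\<^sub>R E b v + (H' x v \<bullet> b) *\<^sub>R F' x b)"
  proof (rule has_derivative_unique[OF K'(1)])
    have "((\<lambda>y. \<Sum>b\<in>Basis. (H y \<bullet> b) *\<^sub>R F' y b) has_derivative
        (\<lambda>v. \<Sum>b\<in>Basis. (H x \<bullet> b) *\<^sub>R E b v + (H' x v \<bullet> b) *\<^sub>R F' x b)) (at x)"
      unfolding E_def by (intro has_derivative_sum has_derivative_scaleR dF has_derivative_inner_left dH)
    then show "(K has_derivative (\<lambda>v. \<Sum>b\<in>Basis. (H x \<bullet> b) *\<^sub>R E b v + (H' x v \<bullet> b) *\<^sub>R F' x b)) (at x)"
      by (rule has_derivative_transform_within_open[OF _ xU(2,1)])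
        (unfold K_def, rule apply_derivative_expand[OF blF, symmetric])
  qed (use xU xV in simp)
  ultimately have "K' x v = D v + F' x (H' x v)"
    unfolding apply_derivative_expand[OF blF[OF xU(1)], of "H' x v"] by (simp add: Hx sum.distrib)
  moreover have "mdiff M (\<lambda>y. mdiff M f y (Y y)) x v = K' x v"
    using mdiff_extension[OF ext x(1) _ x(2)] xU xV by simp
  moreover have "line_deriv Y x v = H' x v"
    using line_deriv_extension[OF H x(1) xV(1) x(2)] .
  ultimately show ?thesis by simp
qed

lemma torsion_free_flat: "torsion_free M flat_connection"
  unfolding torsion_free_def
proof (intro ballI allI impI)
  fix X Y and f :: "'a \<Rightarrow> real" and x
  assume X: "X \<in> vector_fields M" and Y: "Y \<in> vector_fields M" and f: "smooth_map_on M f" and x: "x \<in> M"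
  obtain U F F' where F: "local_extension M f x U F F'"
    using smooth_map_on_local_extension[OF f x] .
  then have U: "open U" "x \<in> U" and Fd: "\<And>y. y \<in> U \<Longrightarrow> (F has_derivative F' y) (at y)"
    and Fs: "\<And>v. smooth_on U (\<lambda>y. F' y v)" by (auto simp: local_extension_def)
  interpret F': bounded_linear "F' x" by (rule local_extension_derivative[OF F])
  obtain A where A: "((\<lambda>y. F' y (Y x)) has_derivative A) (at x)"
    using smooth_on_open_derivative[OF U(1) Fs] U(2) by metis
  obtain B where B: "((\<lambda>y. F' y (X x)) has_derivative B) (at x)"
    using smooth_on_open_derivative[OF U(1) Fs] U(2) by metis
  have T: "X x \<in> T" "Y x \<in> T" using X Y x by (auto simp: vector_fields_eq)
  have "A (X x) = B (Y x)"
    by (rule second_derivative_symmetric[OF U Fd Fs A B])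
  then have "mdiff M (\<lambda>y. mdiff M f y (Y y)) x (X x) - mdiff M (\<lambda>y. mdiff M f y (X y)) x (Y x)
      = F' x (line_deriv Y x (X x) - line_deriv X x (Y x))"
    using iterated_mdiff[OF F Y x T(1) A] iterated_mdiff[OF F X x T(2) B] by (simp add: F'.diff)
  also have "\<dots> = mdiff M f x (line_deriv Y x (X x) - line_deriv X x (Y x))"
    using mdiff_extension[OF F x U(2)] line_deriv_in_T[OF X x T(2)] line_deriv_in_T[OF Y x T(1)]
    by (simp add: subspace_diff[OF subspace_T])
  finally show "mdiff M f x (flat_connection X Y x - flat_connection Y X x) =
      mdiff M (\<lambda>y. mdiff M f y (Y y)) x (X x) - mdiff M (\<lambda>y. mdiff M f y (X y)) x (Y x)"
    using X Y x by (simp add: flat_connection_apply)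
qed

lemma metric_compatible_flat: "metric_compatible M (\<lambda>_. (\<bullet>)) flat_connection"
  unfolding metric_compatible_def
proof (intro ballI)
  fix X Y Z x
  assume X: "X \<in> vector_fields M" and Y: "Y \<in> vector_fields M" and Z: "Z \<in> vector_fields M" and x: "x \<in> M"
  have sm: "smooth_map_on M Y" "smooth_map_on M Z" and v: "X x \<in> T"
    using X Y Z x by (auto simp: vector_fields_eq)
  have "((\<lambda>t. Y (x + t *\<^sub>R X x) \<bullet> Z (x + t *\<^sub>R X x)) has_vector_derivative
      Y (x + 0 *\<^sub>R X x) \<bullet> line_deriv Z x (X x) + line_deriv Y x (X x) \<bullet> Z (x + 0 *\<^sub>R X x)) (at 0)"
    by (intro bounded_bilinear.has_vector_derivative[OF bounded_bilinear_inner] smooth_map_has_line_deriv sm x v)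
  from line_derivI[OF this]
  have "line_deriv (\<lambda>y. Y y \<bullet> Z y) x (X x) = Y x \<bullet> line_deriv Z x (X x) + line_deriv Y x (X x) \<bullet> Z x"
    by simp
  then show "mdiff M (\<lambda>y. Y y \<bullet> Z y) x (X x) = flat_connection X Y x \<bullet> Z x + Y x \<bullet> flat_connection X Z x"
    using X Y Z x v mdiff_eq_line_deriv[OF smooth_map_on_bilinear[OF bounded_bilinear_inner sm] x v]
    by (simp add: flat_connection_apply)
qed

text \<open>The difference \<open>S X Y\<close> of two torsion-free metric connections is symmetric in \<open>X\<close>, \<open>Y\<close>, while
  \<open>S X Y \<bullet> Z\<close> is antisymmetric in \<open>Y\<close>, \<open>Z\<close>; such a trilinear expression vanishes.\<close>

lemma torsion_free_metric_connection_unique: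
  assumes D: "affine_connection M D" "torsion_free M D" "metric_compatible M (\<lambda>_. (\<bullet>)) D"
    and E: "affine_connection M E" "torsion_free M E" "metric_compatible M (\<lambda>_. (\<bullet>)) E"
  shows "D = E"
proof (intro ext)
  fix X Y x
  have field: "D X Y \<in> vector_fields M" "E X Y \<in> vector_fields M"
    if "X \<in> vector_fields M" "Y \<in> vector_fields M" for X Y
    using conjunct1[OF D(1)[unfolded affine_connection_def]]
      conjunct1[OF E(1)[unfolded affine_connection_def]] that by blast+
  have "D X Y = E X Y" if "X \<notin> vector_fields M \<or> Y \<notin> vector_fields M"
    using D(1) E(1) that unfolding affine_connection_def by metis
  moreover have "D X Y x = E X Y x" if XY: "X \<in> vector_fields M" "Y \<in> vector_fields M"
  proof (cases "x \<in> M")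
    case False
    then show ?thesis using field[OF XY] by (simp add: vector_fields_eq)
  next
    case x: True
    define S where "S = (\<lambda>X Y. D X Y x - E X Y x)"
    have in_T: "D X Y x \<in> T" "E X Y x \<in> T"
      if "X \<in> vector_fields M" "Y \<in> vector_fields M" for X Y
      using field[OF that] x by (simp_all add: vector_fields_eq)
    have sym: "S X Y = S Y X" if XY: "X \<in> vector_fields M" "Y \<in> vector_fields M" for X Y
    proof -
      \<comment> \<open>Torsion-freeness speaks of derivations of functions only. Testing it on the
        linear function \<open>y \<bullet> u\<close>, with \<open>u\<close> the difference of the
        two commutators itself, yields \<open>u \<bullet> u = 0\<close>.\<close>
      define u where "u = (D X Y x - D Y X x) - (E X Y x - E Y X x)"
      have sm: "smooth_map_on M (\<lambda>y. y \<bullet> u)"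
        unfolding smooth_map_on_def
        by (auto intro!: exI[of _ UNIV] exI[of _ "\<lambda>y. y \<bullet> u"]
            smooth_on_linear[OF bounded_linear_inner_left] smooth_on_ident)
      have lin: "mdiff M (\<lambda>y. y \<bullet> u) x w = w \<bullet> u" if "w \<in> T" for w
      proof -
        have "((\<lambda>t. (x + t *\<^sub>R w) \<bullet> u) has_vector_derivative w \<bullet> u) (at 0)"
          by (intro has_vector_derivative_line[where f = "\<lambda>y. y \<bullet> u"] bounded_linear_imp_has_derivative
              bounded_linear_inner_left)
        from line_derivI[OF this] mdiff_eq_line_deriv[OF sm x that] show ?thesis by simp
      qed
      have "mdiff M (\<lambda>y. y \<bullet> u) x (D X Y x - D Y X x) = mdiff M (\<lambda>y. y \<bullet> u) x (E X Y x - E Y X x)"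
        unfolding D(2)[unfolded torsion_free_def, rule_format, OF XY sm x]
          E(2)[unfolded torsion_free_def, rule_format, OF XY sm x] ..
      then have "(D X Y x - D Y X x) \<bullet> u = (E X Y x - E Y X x) \<bullet> u"
        using in_T XY by (simp add: lin subspace_diff[OF subspace_T])
      then have "u \<bullet> u = 0" unfolding u_def by (simp add: inner_diff_left)
      then have "u = 0" by simp
      then show ?thesis by (simp add: u_def S_def algebra_simps)
    qed
    have anti: "S X Y \<bullet> Z x = - (S X Z \<bullet> Y x)"
      if "X \<in> vector_fields M" "Y \<in> vector_fields M" "Z \<in> vector_fields M" for X Y Z
    proof -
      have "D X Y x \<bullet> Z x + Y x \<bullet> D X Z x = E X Y x \<bullet> Z x + Y x \<bullet> E X Z x"
        unfolding D(3)[unfolded metric_compatible_def, rule_format, OF that x, symmetric]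
          E(3)[unfolded metric_compatible_def, rule_format, OF that x, symmetric] ..
      then show ?thesis by (simp add: S_def inner_diff_left inner_commute[of "Y x"])
    qed
    \<comment> \<open>Alternating the antisymmetry and the symmetry three times each runs through
      all orders of the three fields and returns to the start with the opposite sign.\<close>
    have zero: "S X Y \<bullet> Z x = 0"
      if "X \<in> vector_fields M" "Y \<in> vector_fields M" "Z \<in> vector_fields M" for X Y Z
      using anti[of X Y Z] anti[of Z X Y] anti[of Y Z X] sym[of X Z] sym[of Z Y] sym[of Y X] that by simp
    \<comment> \<open>The vector is extended to a constant field, so that it can be tested against
      itself.\<close>
    have "S X Y \<in> T" using in_T[OF XY] by (simp add: S_def subspace_diff[OF subspace_T])
    from zero[OF XY const_vector_field[OF this]] x have "S X Y \<bullet> S X Y = 0" by simp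
    then show ?thesis by (simp add: S_def)
  qed
  ultimately show "D X Y x = E X Y x"
    by (cases "X \<in> vector_fields M \<and> Y \<in> vector_fields M") auto
qed

theorem levi_civita_eq: "levi_civita M (\<lambda>_. (\<bullet>)) = flat_connection"
  unfolding levi_civita_def
  using affine_connection_flat torsion_free_flat metric_compatible_flat
  by (auto intro!: the_equality intro: torsion_free_metric_connection_unique)

section \<open>Riemannian gradient and Hessian on a flat submanifold\<close>

lemma rgradI:
  assumes x: "x \<in> M" and w: "w \<in> T" "\<And>v. v \<in> T \<Longrightarrow> w \<bullet> v = mdiff M f x v"
  shows "rgrad M (\<lambda>_. (\<bullet>)) f x = w"
proof -
  have "(THE w. w \<in> T \<and> (\<forall>v\<in>T. w \<bullet> v = mdiff M f x v)) = w"
  proof (rule the_equality)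
    show "w \<in> T \<and> (\<forall>v\<in>T. w \<bullet> v = mdiff M f x v)" using w by blast
    fix w' assume w': "w' \<in> T \<and> (\<forall>v\<in>T. w' \<bullet> v = mdiff M f x v)"
    then have "w' - w \<in> T" using w(1) subspace_T by (blast intro: subspace_diff)
    then have "w' \<bullet> (w' - w) = w \<bullet> (w' - w)" using w' w(2) by metis
    then have "(w' - w) \<bullet> (w' - w) = 0" by (simp only: inner_diff_left)
    then show "w' = w" by simp
  qed
  then show ?thesis by (simp add: rgrad_def tangent_space_eq[OF x] x)
qed

text \<open>The connection is normalised to zero off vector fields, so smoothness of the gradient
  must be secured before the Hessian means anything. It is read off from the expansion in a fixed
  orthonormal basis of \<open>T\<close>.\<close>

lemma rgrad_vector_field:
  assumes f: "smooth_map_on M f"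
  shows "rgrad M (\<lambda>_. (\<bullet>)) f \<in> vector_fields M"
proof -
  obtain B where B: "B \<subseteq> T" "pairwise orthogonal B" "\<And>b. b \<in> B \<Longrightarrow> norm b = 1" "finite B" "span B = T"
    using orthonormal_basis_subspace[OF subspace_T] by (metis independent_imp_finite)
  define G where "G = (\<lambda>x. \<Sum>b\<in>B. line_deriv f x b *\<^sub>R b)"
  have GT: "G x \<in> T" for x
    unfolding G_def using B by (intro subspace_sum subspace_T subspace_scale) auto
  have eq: "rgrad M (\<lambda>_. (\<bullet>)) f x = G x" if x: "x \<in> M" for x
  proof (rule rgradI[OF x GT])
    fix v assume v: "v \<in> T"
    obtain U F F' where F: "local_extension M f x U F F'"
      using smooth_map_on_local_extension[OF f x] .
    then have xU: "x \<in> U" by (simp add: local_extension_def)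
    interpret F': bounded_linear "F' x" by (rule local_extension_derivative[OF F])
    have "F' x v = F' x (\<Sum>b\<in>B. (v \<bullet> b) *\<^sub>R b)"
      using orthonormal_basis_expand[OF B(2,3) _ B(4)] v B(5) by simp
    also have "\<dots> = (\<Sum>b\<in>B. (v \<bullet> b) * line_deriv f x b)"
      unfolding F'.sum F'.scaleR using line_deriv_extension[OF F x xU] B(1)
      by (intro sum.cong) (auto simp: subset_iff)
    finally show "G x \<bullet> v = mdiff M f x v"
      using mdiff_extension[OF F x xU v] by (simp add: G_def inner_sum_left inner_commute[of v] mult.commute)
  qed
  have "smooth_map_on M G"
    unfolding G_def using B(1)
    by (intro smooth_map_on_sum smooth_map_on_linear[OF bounded_linear_scaleR_left] smooth_map_on_line_deriv f
        smooth_map_on_const) auto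
  then have "smooth_map_on M (rgrad M (\<lambda>_. (\<bullet>)) f)"
    by (rule smooth_map_on_cong) (simp add: eq)
  moreover have "rgrad M (\<lambda>_. (\<bullet>)) f x = 0" if "x \<notin> M" for x
    using that by (simp add: rgrad_def)
  ultimately show ?thesis
    using GT by (simp add: vector_fields_eq eq)
qed

text \<open>The constant field provides an extension of \<open>v\<close>, and the flat connection
  depends on the first field only through its value at \<open>x\<close>, so every extension gives
  the same result.\<close>

theorem rhess_eq:
  assumes f: "smooth_map_on M f" and x: "x \<in> M" and v: "v \<in> T"
  shows "rhess M (\<lambda>_. (\<bullet>)) f x v = line_deriv (rgrad M (\<lambda>_. (\<bullet>)) f) x v"
  unfolding rhess_def levi_civita_eq
proof (rule the_equality)
  show "\<exists>X\<in>vector_fields M. X x = v \<and>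
      flat_connection X (rgrad M (\<lambda>_. (\<bullet>)) f) x = line_deriv (rgrad M (\<lambda>_. (\<bullet>)) f) x v"
    using const_vector_field[OF v] x rgrad_vector_field[OF f]
    by (intro bexI[of _ "\<lambda>x. if x \<in> M then v else 0"]) (auto simp: flat_connection_apply)
qed (use x rgrad_vector_field[OF f] in \<open>auto simp: flat_connection_apply\<close>)

end

section \<open>The geometry of core covariance matrices\<close>

lemma subspace_sym_mats: "subspace (sym_mats :: (real^'k^'k) set)"
  by (auto simp: subspace_def sym_mats_def transpose_def vec_eq_iff)

lemma norm_matrix_vector_mult_le: "norm (A *v x) \<le> norm A * norm x" for A :: "real^'k^'l"
proof -
  have "norm (A *v x) = L2_set (\<lambda>i. norm (A $ i \<bullet> x)) UNIV"
    by (simp add: norm_vec_def matrix_vector_mul_component)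
  also have "\<dots> \<le> L2_set (\<lambda>i. norm (A $ i) * norm x) UNIV"
    by (intro L2_set_mono) (auto simp: Cauchy_Schwarz_ineq2)
  also have "\<dots> = norm A * norm x"
    by (simp add: norm_vec_def L2_set_left_distrib)
  finally show ?thesis .
qed

text \<open>The radius is the minimum of the quadratic form on the unit sphere, that is, the
  smallest eigenvalue of \<open>A\<close>. A perturbation of smaller norm cannot make the form
  nonpositive.\<close>

lemma spd_mats_perturb:
  fixes A :: "real^'k^'k"
  assumes "A \<in> spd_mats"
  obtains e where "e > 0" "\<And>B. B \<in> sym_mats \<Longrightarrow> dist B A < e \<Longrightarrow> B \<in> spd_mats"
proof -
  have "continuous_on (sphere 0 1) (\<lambda>x. x \<bullet> (A *v x))"
    by (intro continuous_intros)
  moreover obtain i :: 'k where True by simp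
  then have "axis i 1 \<in> sphere (0 :: real^'k) 1" by simp
  ultimately obtain x where x: "x \<in> sphere 0 1" "\<And>y. y \<in> sphere 0 1 \<Longrightarrow> x \<bullet> (A *v x) \<le> y \<bullet> (A *v y)"
    using continuous_attains_inf[OF compact_sphere, of 0 1] by blast
  define c where "c = x \<bullet> (A *v x)"
  have "x \<noteq> 0" using x(1) by auto
  then have c: "c > 0" using assms by (simp add: c_def spd_mats_def)
  have "B \<in> spd_mats" if B: "B \<in> sym_mats" "dist B A < c" for B
  proof -
    have "y \<bullet> (B *v y) > 0" if y: "y \<noteq> 0" for y
    proof -
      have "c \<le> ((1 / norm y) *\<^sub>R y) \<bullet> (A *v ((1 / norm y) *\<^sub>R y))"
        unfolding c_def using y by (intro x(2)) simp
      then have "c \<le> (y \<bullet> (A *v y)) / (norm y)\<^sup>2"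
        by (simp add: matrix_vector_mult_scaleR power2_eq_square)
      then have A: "c * (norm y)\<^sup>2 \<le> y \<bullet> (A *v y)"
        using y by (simp add: pos_le_divide_eq)
      have "\<bar>y \<bullet> ((B - A) *v y)\<bar> \<le> norm y * (norm (B - A) * norm y)"
        by (rule order_trans[OF Cauchy_Schwarz_ineq2 mult_left_mono[OF norm_matrix_vector_mult_le]]) simp
      also have "\<dots> = norm (B - A) * (norm y)\<^sup>2" by (simp add: power2_eq_square)
      also have "\<dots> < c * (norm y)\<^sup>2"
        using B(2) y by (intro mult_strict_right_mono) (simp_all add: dist_norm)
      finally have "\<bar>y \<bullet> ((B - A) *v y)\<bar> < c * (norm y)\<^sup>2" .
      moreover have "y \<bullet> (B *v y) = y \<bullet> (A *v y) + y \<bullet> ((B - A) *v y)"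
        by (simp add: matrix_vector_mult_diff_rdistrib inner_diff_right)
      ultimately show ?thesis using A by linarith
    qed
    with B(1) show ?thesis by (simp add: spd_mats_def)
  qed
  with c that show ?thesis by blast
qed

lemma trace_inner_eq: "trace_inner = (\<bullet>)"
proof (intro ext)
  fix U V :: "real^'k^'k"
  have "trace_inner U V = (\<Sum>i\<in>UNIV. \<Sum>k\<in>UNIV. U $ k $ i * V $ k $ i)"
    by (simp add: trace_inner_def trace_def matrix_matrix_mult_def transpose_def)
  also have "\<dots> = U \<bullet> V"
    unfolding inner_vec_def inner_real_def by (rule sum.swap)
  finally show "trace_inner U V = U \<bullet> V" .
qed

lemma gE_eq: "gE = (\<lambda>_. (\<bullet>))"
  by (simp add: fun_eq_iff gE_def trace_inner_eq)

definition core_tangent :: "('n::finite, 'm::finite) bmat set" where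
  "core_tangent = {W \<in> sym_mats. tr1 W = 0 \<and> tr2 W = 0}"

lemma linear_tr1: "linear tr1"
  by (rule linearI) (simp_all add: vec_eq_iff tr1_nth sum.distrib sum_distrib_left)

lemma linear_tr2: "linear tr2"
  by (rule linearI) (simp_all add: vec_eq_iff tr2_nth sum.distrib sum_distrib_left)

lemma linear_trace: "linear (trace :: real^'k^'k \<Rightarrow> real)"
  by (rule linearI) (simp_all add: trace_def sum.distrib sum_distrib_left)

interpretation core: flat_submanifold "core_covs :: ('n::finite, 'm::finite) bmat set" core_tangent
proof
  show "subspace (core_tangent :: ('n, 'm) bmat set)"
    using subspace_sym_mats by (auto simp: subspace_def core_tangent_def linear_0[OF linear_tr1] linear_0[OF linear_tr2]
      linear_add[OF linear_tr1] linear_add[OF linear_tr2] linear_scale[OF linear_tr1] linear_scale[OF linear_tr2])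
  fix x y v :: "('n, 'm) bmat"
  assume x: "x \<in> core_covs"
  show "y - x \<in> core_tangent" if "y \<in> core_covs"
    using x that by (auto simp: core_covs_eq core_tangent_def linear_diff[OF linear_tr1] linear_diff[OF linear_tr2]
        spd_mats_def intro: subspace_diff[OF subspace_sym_mats])
  assume v: "v \<in> core_tangent"
  have "x \<in> spd_mats" using x by (simp add: core_covs_eq)
  then obtain e where e: "e > 0" "\<And>B. B \<in> sym_mats \<Longrightarrow> dist B x < e \<Longrightarrow> B \<in> spd_mats"
    using spd_mats_perturb by blast
  \<comment> \<open>The \<open>+ 1\<close> keeps the bound on \<open>t\<close> meaningful for
    \<open>v = 0\<close>.\<close>
  have "x + t *\<^sub>R v \<in> core_covs" if t: "\<bar>t\<bar> < e / (norm v + 1)" for t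
  proof -
    have "x + t *\<^sub>R v \<in> sym_mats"
      using x v by (auto simp: core_covs_eq spd_mats_def core_tangent_def
          intro!: subspace_add[OF subspace_sym_mats] subspace_scale[OF subspace_sym_mats])
    moreover have "dist (x + t *\<^sub>R v) x < e"
    proof -
      have "dist (x + t *\<^sub>R v) x \<le> \<bar>t\<bar> * (norm v + 1)"
        by (simp add: dist_norm mult_left_mono)
      also have "\<dots> < e" using t by (simp add: pos_less_divide_eq add_nonneg_pos)
      finally show ?thesis .
    qed
    ultimately have "x + t *\<^sub>R v \<in> spd_mats" by (rule e(2))
    with x v show ?thesis
      by (simp add: core_covs_eq core_tangent_def linear_add[OF linear_tr1] linear_add[OF linear_tr2]
          linear_scale[OF linear_tr1] linear_scale[OF linear_tr2])
  qed
  moreover have "e / (norm v + 1) > 0" using e(1) by (simp add: add_nonneg_pos)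
  ultimately show "\<exists>e>0. \<forall>t. \<bar>t\<bar> < e \<longrightarrow> x + t *\<^sub>R v \<in> core_covs" by blast
qed

section \<open>\<open>G_op\<close> as an orthogonal projection\<close>

lemma trace_tr1: "trace (tr1 X) = trace X"
  unfolding trace_def tr1_nth sum_UNIV_prod by (rule sum.swap)

lemma trace_tr2: "trace (tr2 X) = trace X"
  by (simp add: trace_def tr2_nth sum_UNIV_prod)

lemma tr1_kron: "tr1 (kron A B) = trace A *\<^sub>R B"
  by (simp add: vec_eq_iff tr1_nth kron_nth trace_def sum_distrib_right)

lemma tr2_kron: "tr2 (kron A B) = trace B *\<^sub>R A"
  by (simp add: vec_eq_iff tr2_nth kron_nth trace_def sum_distrib_left mult.commute)

lemma tr1_mat_1: "tr1 (mat 1 :: ('n::finite, 'm::finite) bmat) = real CARD('n) *\<^sub>R mat 1"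
  by (simp add: tr1_kron trace_I flip: kron_mat_1)

lemma tr2_mat_1: "tr2 (mat 1 :: ('n::finite, 'm::finite) bmat) = real CARD('m) *\<^sub>R mat 1"
  by (simp add: tr2_kron trace_I flip: kron_mat_1)

text \<open>The map \<open>kron (mat 1)\<close> is the adjoint of \<open>tr1\<close>, so its image
  is orthogonal to the kernel of \<open>tr1\<close>.\<close>

lemma kron_mat_1_inner_left: "kron (mat 1) A \<bullet> W = A \<bullet> tr1 W"
proof -
  have "kron (mat 1) A \<bullet> W = trace (transpose (kron (mat 1) A) ** W)"
    by (simp add: trace_inner_def flip: trace_inner_eq)
  also have "\<dots> = trace (tr1 (kron (mat 1) (transpose A) ** W))"
    by (simp add: transpose_kron trace_tr1)
  finally show ?thesis
    by (simp add: tr1_kron_mult_left trace_inner_def flip: trace_inner_eq)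
qed

lemma kron_mat_1_inner_right: "kron A (mat 1) \<bullet> W = A \<bullet> tr2 W"
proof -
  have "kron A (mat 1) \<bullet> W = trace (transpose (kron A (mat 1)) ** W)"
    by (simp add: trace_inner_def flip: trace_inner_eq)
  also have "\<dots> = trace (tr2 (kron (transpose A) (mat 1) ** W))"
    by (simp add: transpose_kron trace_tr2)
  finally show ?thesis
    by (simp add: tr2_kron_mult_left trace_inner_def flip: trace_inner_eq)
qed

text \<open>Each Kronecker correction cancels one partial trace but adds a multiple of the identity
  to the other; the last term of \<open>G_op\<close> compensates both of these at once.\<close>

lemma G_op_in_core_tangent:
  fixes X :: "('n::finite, 'm::finite) bmat"
  assumes "X \<in> sym_mats"
  shows "G_op X \<in> core_tangent"
proof -
  have 1: "tr1 (G_op X) = 0"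
    by (simp add: G_op_def linear_add[OF linear_tr1] linear_diff[OF linear_tr1] linear_scale[OF linear_tr1]
        tr1_kron tr1_mat_1 trace_I trace_tr2 divide_simps)
  have 2: "tr2 (G_op X) = 0"
    by (simp add: G_op_def linear_add[OF linear_tr2] linear_diff[OF linear_tr2] linear_scale[OF linear_tr2]
        tr2_kron tr2_mat_1 trace_I trace_tr1 divide_simps)
  have "kron (mat 1) (tr1 X) \<in> sym_mats" "kron (tr2 X) (mat 1) \<in> sym_mats" "mat 1 \<in> sym_mats"
    using assms by (simp_all add: sym_mats_def transpose_kron transpose_tr1 transpose_tr2)
  then have "G_op X \<in> sym_mats"
    unfolding G_op_def using assms
    by (intro subspace_add subspace_diff subspace_scale subspace_sym_mats)
  with 1 2 show ?thesis by (simp add: core_tangent_def)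
qed

text \<open>By adjointness all correction terms are orthogonal to \<open>core_tangent\<close>.
  Together with the membership above this makes \<open>G_op\<close> the orthogonal projection of the
  symmetric matrices.\<close>

lemma G_op_inner: "W \<in> core_tangent \<Longrightarrow> G_op X \<bullet> W = X \<bullet> W"
proof -
  assume W: "W \<in> core_tangent"
  have "mat 1 \<bullet> W = 0"
    using W kron_mat_1_inner_left[of "mat 1" W] by (simp add: core_tangent_def)
  with W show ?thesis
    by (simp add: G_op_def inner_add_left inner_diff_left kron_mat_1_inner_left kron_mat_1_inner_right core_tangent_def)
qed

lemma linear_kron_left: "linear (\<lambda>A. kron A B)"
  by (rule linearI) (simp_all add: vec_eq_iff kron_nth algebra_simps)

lemma linear_kron_right: "linear (kron A)"
  by (rule linearI) (simp_all add: vec_eq_iff kron_nth algebra_simps)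

lemma bounded_linear_G_op:
  "bounded_linear (G_op :: ('n::finite, 'm::finite) bmat \<Rightarrow> ('n, 'm) bmat)"
proof -
  have "linear (G_op :: ('n, 'm) bmat \<Rightarrow> ('n, 'm) bmat)"
    by (intro linearI) (simp_all add: G_op_def linear_add[OF linear_tr1] linear_add[OF linear_tr2] linear_scale[OF linear_tr1]
       linear_scale[OF linear_tr2] linear_add[OF linear_trace] linear_scale[OF linear_trace]
       linear_add[OF linear_kron_left] linear_add[OF linear_kron_right]
       linear_scale[OF linear_kron_left] linear_scale[OF linear_kron_right]
       scaleR_add_right scaleR_diff_right scaleR_add_left add_divide_distrib)
  then show ?thesis by (simp add: linear_conv_bounded_linear)
qed

section \<open>Derivatives within a subspace; Euclidean gradient and Hessian\<close>

lemma has_derivative_within_subspace_line: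
  assumes "subspace S" "x \<in> S" "v \<in> S" "(f has_derivative f') (at x within S)"
  shows "((\<lambda>t. f (x + t *\<^sub>R v)) has_vector_derivative f' v) (at 0)"
proof -
  interpret f': bounded_linear f' using assms(4) by (rule has_derivative_bounded_linear)
  have "((\<lambda>t. x + t *\<^sub>R v) has_derivative (\<lambda>t. t *\<^sub>R v)) (at 0)"
    by (auto intro!: derivative_eq_intros)
  moreover have "range (\<lambda>t. x + t *\<^sub>R v) \<subseteq> S"
    using assms by (auto intro!: subspace_add subspace_scale)
  then have "(f has_derivative f') (at (x + 0 *\<^sub>R v) within range (\<lambda>t. x + t *\<^sub>R v))"
    using assms(4) by (auto intro: has_derivative_subset)
  ultimately have "((\<lambda>t. f (x + t *\<^sub>R v)) has_derivative (\<lambda>t. f' (t *\<^sub>R v))) (at 0)"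
    by (rule has_derivative_in_compose)
  then show ?thesis by (simp add: has_vector_derivative_def f'.scaleR)
qed

lemma has_derivative_within_subspace_unique:
  assumes "subspace S" "x \<in> S" "v \<in> S"
    and "(f has_derivative f') (at x within S)" "(f has_derivative f'') (at x within S)"
  shows "f' v = f'' v"
  using has_derivative_within_subspace_line[OF assms(1-3)] assms(4,5)
  by (blast intro: vector_derivative_unique_at)

text \<open>The difference quotient within \<open>S\<close> evaluates the derivative at
  \<open>y - x\<close> with both points in \<open>S\<close>, so its values off \<open>S\<close> can
  be replaced.\<close>

lemma has_derivative_within_subspace_cong:
  assumes S: "subspace S" "x \<in> S" and f: "(f has_derivative f') (at x within S)"
    and g': "bounded_linear g'" "\<And>v. v \<in> S \<Longrightarrow> f' v = g' v"
  shows "(f has_derivative g') (at x within S)"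
proof -
  have "\<forall>\<^sub>F y in at x within S. (1 / norm (y - x)) *\<^sub>R (f y - (f x + f' (y - x)))
      = (1 / norm (y - x)) *\<^sub>R (f y - (f x + g' (y - x)))"
    unfolding eventually_at_filter
    by (rule always_eventually) (use S in \<open>simp add: g'(2) subspace_diff\<close>)
  with f g'(1) show ?thesis
    unfolding has_derivative_within by (auto simp: tendsto_cong)
qed

text \<open>Order two accounts for one derivative in \<open>egrad\<close> and a second one in
  \<open>ehess\<close>.\<close>

locale symmetric_extension =
  fixes U :: "(real^'k^'k) set" and F :: "real^'k^'k \<Rightarrow> real"
  assumes U: "openin (top_of_set sym_mats) U" and F: "Ck_on 2 U F"
begin

lemma U_sym: "X \<in> U \<Longrightarrow> X \<in> sym_mats"
  using openin_subset[OF U] by auto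

lemma at_within_U: "X \<in> U \<Longrightarrow> at X within U = at X within sym_mats"
proof -
  assume X: "X \<in> U"
  obtain O' where "open O'" "U = sym_mats \<inter> O'" using U by (auto simp: openin_open)
  then show ?thesis
    using X by (intro at_within_nhd[of X O']) auto
qed

text \<open>\<open>egrad\<close> is a definite description and says nothing about regularity. An
  explicit representing matrix, linear in finitely many values of \<open>F'\<close>, inherits
  differentiability from them.\<close>

lemma egrad_exists_differentiable:
  obtains G where "\<And>X. X \<in> U \<Longrightarrow> G X \<in> sym_mats"
    "\<And>X. X \<in> U \<Longrightarrow> (F has_derivative (\<lambda>V. G X \<bullet> V)) (at X within sym_mats)"
    "\<And>X. X \<in> U \<Longrightarrow> G differentiable (at X within U)"
proof -
  obtain F' where F': "\<And>X. X \<in> U \<Longrightarrow> (F has_derivative F' X) (at X within U)"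
    and C1: "\<And>v. Ck_on 1 U (\<lambda>X. F' X v)"
    using F by (auto simp: numeral_2_eq_2)
  define W :: "real^'k^'k \<Rightarrow> real^'k^'k" where "W = (\<lambda>B. (1/2) *\<^sub>R (B + transpose B))"
  have transpose_inner: "transpose A \<bullet> B = A \<bullet> transpose B" for A B :: "real^'k^'k"
    unfolding inner_vec_def transpose_def by (simp add: inner_vec_def) (rule sum.swap)
  have "linear (transpose :: real^'k^'k \<Rightarrow> real^'k^'k)"
    by (rule linearI) (simp_all add: transpose_def vec_eq_iff)
  then have linW: "linear W"
    unfolding W_def by (intro linear_compose_scale_right linear_compose_add linear_ident)
  have W_sym: "W B \<in> sym_mats" for B
    by (simp add: W_def sym_mats_def transpose_def vec_eq_iff)
  have W_id: "W B = B" if "B \<in> sym_mats" for B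
    using that by (simp add: W_def sym_mats_def scaleR_2[symmetric])
  have W_inner: "W B \<bullet> V = B \<bullet> V" if "V \<in> sym_mats" for B V
    using that by (simp add: W_def inner_add_left transpose_inner sym_mats_def)
  \<comment> \<open>Riesz representation in the standard basis. The symmetrisation \<open>W\<close>
    is applied twice: inside \<open>F' X\<close>, so that only symmetric directions occur, and
    outside, so that the result is symmetric.\<close>
  define G where "G = (\<lambda>X. \<Sum>b\<in>Basis. F' X (W b) *\<^sub>R W b)"
  show ?thesis
  proof (rule that[of G])
    fix X assume X: "X \<in> U"
    show "G X \<in> sym_mats"
      unfolding G_def by (intro subspace_sum subspace_scale subspace_sym_mats W_sym)
    interpret F': bounded_linear "F' X" using F'[OF X] by (rule has_derivative_bounded_linear)
    have "F' X V = G X \<bullet> V" if V: "V \<in> sym_mats" for V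
    proof -
      have "F' X V = F' X (W (\<Sum>b\<in>Basis. (V \<bullet> b) *\<^sub>R b))"
        using W_id[OF V] by (simp only: euclidean_representation)
      also have "\<dots> = (\<Sum>b\<in>Basis. (V \<bullet> b) * F' X (W b))"
        by (simp add: linear_sum[OF linW] linear_scale[OF linW] F'.sum F'.scaleR)
      also have "\<dots> = G X \<bullet> V"
        by (simp add: G_def inner_sum_left W_inner[OF V] inner_commute[of V] mult.commute)
      finally show ?thesis .
    qed
    then show "(F has_derivative (\<lambda>V. G X \<bullet> V)) (at X within sym_mats)"
      by (rule has_derivative_within_subspace_cong[OF subspace_sym_mats U_sym[OF X]
          F'[OF X, unfolded at_within_U[OF X]] bounded_linear_inner_right])
    have "(\<lambda>X. F' X v) differentiable (at X within U)" for v
      using C1[of v] X by (auto simp: differentiable_def)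
    then show "G differentiable (at X within U)"
      unfolding G_def by (intro differentiable_sum differentiable_scaleR) auto
  qed
qed

lemma egrad_props:
  assumes X: "X \<in> U"
  shows "egrad F X \<in> sym_mats"
    and "(F has_derivative (\<lambda>V. egrad F X \<bullet> V)) (at X within sym_mats)"
    and "(egrad F has_derivative ehess F X) (at X within sym_mats)"
proof -
  obtain G where G: "\<And>X. X \<in> U \<Longrightarrow> G X \<in> sym_mats"
    "\<And>X. X \<in> U \<Longrightarrow> (F has_derivative (\<lambda>V. G X \<bullet> V)) (at X within sym_mats)"
    "\<And>X. X \<in> U \<Longrightarrow> G differentiable (at X within U)"
    using egrad_exists_differentiable by blast
  \<comment> \<open>Needed on all of \<open>U\<close>, because the derivative of
    \<open>egrad F\<close> depends on its values at nearby points.\<close>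
  have eq: "egrad F X = G X" if X: "X \<in> U" for X
    unfolding egrad_def trace_inner_eq
  proof (rule the_equality)
    fix G' assume G': "G' \<in> sym_mats \<and> (F has_derivative (\<lambda>V. G' \<bullet> V)) (at X within sym_mats)"
    then have d: "G' - G X \<in> sym_mats"
      using G(1)[OF X] by (auto intro: subspace_diff subspace_sym_mats)
    from has_derivative_within_subspace_unique[OF subspace_sym_mats U_sym[OF X] d _ G(2)[OF X]] G'
    have "(G' - G X) \<bullet> (G' - G X) = 0" by (simp only: inner_diff_left) simp
    then show "G' = G X" by simp
  qed (use G X in blast)
  show "egrad F X \<in> sym_mats" "(F has_derivative (\<lambda>V. egrad F X \<bullet> V)) (at X within sym_mats)"
    using G X by (simp_all add: eq)
  obtain D where "(G has_derivative D) (at X within U)"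
    using G(3)[OF X] by (auto simp: differentiable_def)
  then have "(egrad F has_derivative D) (at X within U)"
    by (rule has_derivative_transform[OF X, rotated]) (simp add: eq)
  then have "egrad F differentiable (at X within sym_mats)"
    using at_within_U[OF X] by (auto simp: differentiable_def)
  then show "(egrad F has_derivative ehess F X) (at X within sym_mats)"
    unfolding ehess_def[abs_def] by (simp add: frechet_derivative_works)
qed

end

theorem proposition5p5:
  fixes f F :: "('n::finite, 'm::finite) bmat \<Rightarrow> real"
    and C V :: "('n, 'm) bmat"
    and U :: "('n, 'm) bmat set"
  assumes "CARD('m) \<ge> 2" and "CARD('n) \<ge> 2"
    and "smooth_map_on core_covs f"
    and "C \<in> core_covs"
    and "V \<in> tangent_space core_covs C"
    and "openin (top_of_set sym_mats) U" and "C \<in> U"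
    and "smooth_on U F" and "\<forall>X\<in>U \<inter> core_covs. F X = f X"
  shows "rgrad core_covs gE f C = G_op (egrad F C) \<and>
         rhess core_covs gE f C V = G_op (ehess F C V)"
proof
  interpret symmetric_extension U F
    using assms(6,8) by unfold_locales (auto simp: smooth_on_def)
  note f = assms(3) and C = assms(4)
  obtain O' where O': "open O'" "U = sym_mats \<inter> O'" using assms(6) by (auto simp: openin_open)
  have V: "V \<in> core_tangent" using assms(5) core.tangent_space_eq[OF C] by simp
  have core_sym: "X \<in> sym_mats" if "X \<in> core_covs" for X :: "('n, 'm) bmat"
    using that by (simp add: core_covs_eq spd_mats_def)
  have tangent_sym: "W \<in> sym_mats" if "W \<in> core_tangent" for W :: "('n, 'm) bmat"
    using that by (simp add: core_tangent_def)
  \<comment> \<open>\<open>U\<close> is open only among the symmetric matrices; core points are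
    symmetric, so those near a point of \<open>U\<close> belong to \<open>U\<close>.\<close>
  have ev: "\<forall>\<^sub>F Y in nhds X. Y \<in> core_covs \<longrightarrow> Y \<in> U" if "X \<in> U" for X
    using eventually_nhds_in_open[OF O'(1), of X] that O'(2)
    by (auto elim!: eventually_mono simp: core_sym)
  \<comment> \<open>Established at every core point of \<open>U\<close>: the Hessian differentiates
    this identity along a line, so its validity at \<open>C\<close> alone would not do.\<close>
  have grad: "rgrad core_covs gE f X = G_op (egrad F X)" if X: "X \<in> core_covs" "X \<in> U" for X
    unfolding gE_eq
  proof (rule core.rgradI[OF X(1) G_op_in_core_tangent[OF egrad_props(1)[OF X(2)]]])
    fix W :: "('n, 'm) bmat" assume W: "W \<in> core_tangent"
    have deriv: "((\<lambda>t. F (X + t *\<^sub>R W)) has_vector_derivative egrad F X \<bullet> W) (at 0)"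
      using core_sym[OF X(1)] tangent_sym[OF W] egrad_props(2)[OF X(2)]
      by (intro has_derivative_within_subspace_line[OF subspace_sym_mats, where f = F])
    have eq: "\<forall>\<^sub>F Y in nhds X. Y \<in> core_covs \<longrightarrow> F Y = f Y"
      using ev[OF X(2)] by eventually_elim (use assms(9) in blast)
    from core.has_vector_derivative_line_cong[OF X(1) W eq deriv] have "mdiff core_covs f X W = egrad F X \<bullet> W"
      using core.mdiff_eq_line_deriv[OF f X(1) W] by (simp add: line_derivI)
    then show "G_op (egrad F X) \<bullet> W = mdiff core_covs f X W"
      by (simp add: G_op_inner[OF W])
  qed
  show "rgrad core_covs gE f C = G_op (egrad F C)"
    by (rule grad[OF C assms(7)])
  have "((\<lambda>t. egrad F (C + t *\<^sub>R V)) has_vector_derivative ehess F C V) (at 0)"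
    by (rule has_derivative_within_subspace_line[OF subspace_sym_mats core_sym[OF C] tangent_sym[OF V]
          egrad_props(3)[OF assms(7)]])
  then have deriv: "((\<lambda>t. G_op (egrad F (C + t *\<^sub>R V))) has_vector_derivative G_op (ehess F C V)) (at 0)"
    by (rule bounded_linear.has_vector_derivative[OF bounded_linear_G_op])
  have eq: "\<forall>\<^sub>F Y in nhds C. Y \<in> core_covs \<longrightarrow> G_op (egrad F Y) = rgrad core_covs gE f Y"
    using ev[OF assms(7)] by eventually_elim (simp add: grad)
  from line_derivI[OF core.has_vector_derivative_line_cong[OF C V eq deriv]]
  show "rhess core_covs gE f C V = G_op (ehess F C V)"
    unfolding gE_eq core.rhess_eq[OF f C V] .
qed

end
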